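(* For complex parameters $\alpha,a,b,c,\beta,\gamma,u$ with $\max\bigl\{\bigl|\alpha \beta abc/q^2\bigr|, \bigl|\alpha \gamma abc/q^2\bigr| \bigr\}<1$, we have \begin{align*} &\sum_{n=0}^\infty \frac{\bigl(1-\alpha q^{2n}\bigr)(\alpha, q/a, q/b, q/c; q)_n}{(1-\alpha)(q, \alpha a, \alpha b, \alpha c; q)_n}\biggl(\frac{\alpha abc}{q^2}\biggr)^n {}_4\phi_3\biggl({{q^{-n}, \alpha q^n, \beta, \gamma}\atop{q/a, q/b, \beta \gamma u}}; q, q\biggr)\\ &\qquad=\frac{(q\alpha, \alpha ac/q, \alpha bc/q, \alpha \beta ab/q; q )_\infty}{\bigl(\alpha a, \alpha b, \alpha c, \alpha \beta abc/q^2; q \bigr)_\infty}\, {}_3\phi_2 \biggl({{q/c, \beta u, \beta}\atop{\alpha \beta ab/q, \beta \gamma u}}; q, \frac{\alpha \gamma abc}{q^2}\biggr). \end{align*}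
   Context: Throughout, $q$ is a complex number with $0<|q|<1$. For $x\in\mathbb{C}$, $(x;q)_\infty=\prod_{k=0}^\infty(1-xq^k)$ and, for an integer $n\ge 0$, $(x;q)_n=\prod_{k=0}^{n-1}(1-xq^k)$; also $(x_1,\dots,x_m;q)_n=(x_1;q)_n\cdots(x_m;q)_n$ for $n$ an integer or $\infty$. The basic hypergeometric series is ${}_r\phi_s\Bigl({{a_1,\dots,a_r}\atop{b_1,\dots,b_s}};q,z\Bigr)=\sum_{n=0}^\infty \frac{(a_1,\dots,a_r;q)_n}{(q,b_1,\dots,b_s;q)_n}\bigl((-1)^nq^{n(n-1)/2}\bigr)^{1+s-r}z^n$. *)

theory Defs
  imports "HOL-Analysis.Analysis"
begin

definition qpoch :: "complex \<Rightarrow> complex \<Rightarrow> nat \<Rightarrow> complex" where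
  "qpoch x q n = (\<Prod>k<n. 1 - x * q ^ k)"

definition qpoch_inf :: "complex \<Rightarrow> complex \<Rightarrow> complex" where
  "qpoch_inf x q = (\<Prod>k. 1 - x * q ^ k)"

definition qpochs :: "complex list \<Rightarrow> complex \<Rightarrow> nat \<Rightarrow> complex" where
  "qpochs xs q n = prod_list (map (\<lambda>x. qpoch x q n) xs)"

definition qpochs_inf :: "complex list \<Rightarrow> complex \<Rightarrow> complex" where
  "qpochs_inf xs q = prod_list (map (\<lambda>x. qpoch_inf x q) xs)"

definition qphi :: "complex list \<Rightarrow> complex list \<Rightarrow> complex \<Rightarrow> complex \<Rightarrow> complex" where
  "qphi as bs q z = (\<Sum>n. qpochs as q n / qpochs (q # bs) q n
      * ((-1) ^ n * q ^ (n * (n - 1) div 2)) powi (int (1 + length bs) - int (length as))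
      * z ^ n)"

end

theory Submission
  imports Defs "HOL-Complex_Analysis.Complex_Analysis"
begin

text \<open>
  Expanding \<open>(\<gamma>; q)_k / (\<beta>\<gamma>u; q)_k\<close> by the q-Chu--Vandermonde sum and interchanging summations reduces
  the identity to the case where \<open>\<gamma>\<close> is absent, with all other parameters shifted by powers of \<open>q\<close>;
  there the right-hand side is a quotient of infinite products. When \<open>c = q^(N+1)\<close>, the reduced
  identity is a finite sum: interchanging the two summations leaves the terminating very-well-poised
  6-phi-5 sum inside and the q-Vandermonde sum outside. The general case follows by analytic
  continuation in \<open>c\<close>, since the points \<open>q^(N+1)\<close> accumulate at 0. Both the continuation and the
  interchange of infinite sums need geometric growth of the inner terminating series, which is invisible
  from its definition because of massive cancellation; it is read off from a transformation into
  a sum with bounded coefficients.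
\<close>

text \<open>The defining terms of the inner series carry q^(-nk) and can reach size about
  |q|^(-n^2/2), whereas the series without \<gamma> grows at most like r^n for any positive r >=
  |\<beta>|; termwise estimates therefore cannot reach the stated region of convergence. The
  continuation variable is d = c/q: c enters through d^n (q/c; q)_n, the product of the d - q^k,
  which is polynomial in d, and multiplying by (\<alpha>c; q)_\<infinity> clears the only
  denominators containing c. So 0 becomes an interior point of the domain, as the identity theorem
  demands. With y = \<alpha>ab/q, the rates |y| of the weight, |d| of this product and |\<beta>| of
  the inner series multiply to |\<alpha>\<beta>abc/q^2|; the hypothesis with \<gamma> in place of
  \<beta> governs the outer sum once \<gamma> is expanded. In that double sum row j uses d/q^j,
  which leaves every fixed disc; \<beta>q^j in the inner series compensates, and the estimates are
  therefore made uniform in j.\<close>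

section \<open>Homogeneous shifted factorials, sign factors and q-binomials\<close>

text \<open>The homogeneous form x^n (y/x; q)_n, which remains meaningful at x = 0.\<close>

definition hpoch :: "complex \<Rightarrow> complex \<Rightarrow> complex \<Rightarrow> nat \<Rightarrow> complex" where
  "hpoch x y q n = (\<Prod>k<n. x - y * q ^ k)"

definition qsgn :: "complex \<Rightarrow> nat \<Rightarrow> complex" where
  "qsgn q n = (-1) ^ n * q ^ (n choose 2)"

definition qbin :: "complex \<Rightarrow> nat \<Rightarrow> nat \<Rightarrow> complex" where
  "qbin q n k = (if k \<le> n then qpoch q q n / (qpoch q q k * qpoch q q (n - k)) else 0)"

lemma hpoch_0 [simp]: "hpoch x y q 0 = 1"
  and hpoch_Suc: "hpoch x y q (Suc n) = hpoch x y q n * (x - y * q ^ n)"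
  by (simp_all add: hpoch_def)

lemma hpoch_Suc_shift: "hpoch x y q (Suc n) = (x - y) * hpoch x (y * q) q n"
  by (simp add: hpoch_def prod.lessThan_Suc_shift mult.assoc del: prod.lessThan_Suc)

lemma hpoch_scale: "hpoch (c * x) (c * y) q n = c ^ n * hpoch x y q n"
  by (induction n) (simp_all add: hpoch_Suc algebra_simps)

lemma hpoch_add: "hpoch x y q (m + n) = hpoch x y q m * hpoch x (y * q ^ m) q n"
  by (induction n) (simp_all add: hpoch_Suc power_add mult.assoc)

lemma qpoch_conv_hpoch: "qpoch x q n = hpoch 1 x q n"
  by (simp add: qpoch_def hpoch_def)

lemma qpoch_0 [simp]: "qpoch x q 0 = 1"
  and qpoch_Suc: "qpoch x q (Suc n) = qpoch x q n * (1 - x * q ^ n)"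
  by (simp_all add: qpoch_def)

lemma qpoch_Suc_shift: "qpoch x q (Suc n) = (1 - x) * qpoch (x * q) q n"
  by (simp add: qpoch_conv_hpoch hpoch_Suc_shift)

lemma qpoch_add: "qpoch x q (m + n) = qpoch x q m * qpoch (x * q ^ m) q n"
  by (simp add: qpoch_conv_hpoch hpoch_add)

lemma qsgn_0 [simp]: "qsgn q 0 = 1"
  and qsgn_Suc: "qsgn q (Suc n) = - (qsgn q n * q ^ n)"
  by (simp_all add: qsgn_def numeral_2_eq_2 power_add)

lemma qsgn_add: "qsgn q (m + n) = qsgn q m * qsgn q n * q ^ (m * n)"
  by (induction n) (simp_all add: qsgn_Suc power_add)

text \<open>The source of every cancellation of quadratic exponents below: 2 (n choose 2) + n =
  n^2.\<close>

lemma qsgn_square: "qsgn q n * qsgn q n * q ^ n = q ^ (n * n)"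
proof -
  have "qsgn q n * qsgn q n = q ^ (2 * (n choose 2))"
    by (simp add: qsgn_def power_mult power2_eq_square mult_ac flip: power_mult_distrib)
  moreover have "2 * (n choose 2) + n = n * n"
    by (induction n) (simp_all add: numeral_2_eq_2)
  ultimately show ?thesis
    by (simp flip: power_add)
qed

section \<open>Real-analytic tools: room below a strict bound, interchange of double sums\<close>

lemma ex_greater_mult_less_one:
  fixes x y :: real
  assumes "x \<ge> 0" "x * y < 1"
  obtains z where "z > y" "x * z < 1"
proof (cases "x = 0")
  case False
  with assms have "y < 1 / x"
    by (simp add: field_simps)
  then obtain z where "y < z" "z < 1 / x"
    using dense by blast
  with False assms that show ?thesis
    by (simp add: field_simps)
qed (use that[of "y + 1"] in auto)

text \<open>The geometric majorant in both indices gives absolute summability over all pairs (j, m);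
  the same total is then read off by rows and, through the bijection (j, m) to (j + m, j), by
  antidiagonals.\<close>

lemma sums_triangle_swap:
  fixes f :: "nat \<Rightarrow> nat \<Rightarrow> complex"
  assumes bound: "\<And>j m. norm (f j m) \<le> C * s ^ j * t ^ m"
    and st: "0 \<le> s" "s < 1" "0 \<le> t" "t < 1"
    and inner: "\<And>j. f j sums g j"
  shows "summable g" "(\<lambda>n. \<Sum>j\<le>n. f j (n - j)) sums suminf g"
proof -
  have bound_summable: "(\<lambda>x. norm (case x of (j, m) \<Rightarrow> C * s ^ j * t ^ m)) summable_on UNIV \<times> UNIV"
  proof -
    have geom: "(\<lambda>m. t ^ m) summable_on UNIV" "(\<lambda>j. s ^ j) summable_on UNIV"
      using st by (simp_all add: summable_on_UNIV_nonneg_real_iff summable_geometric)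
    have "(\<lambda>m. norm (C * s ^ j * t ^ m)) summable_on UNIV" for j
      using summable_on_cmult_right[OF geom(1), of "\<bar>C\<bar> * s ^ j"] st by (simp add: abs_mult)
    moreover have "(\<lambda>j. norm (\<Sum>\<^sub>\<infinity>m. norm (C * s ^ j * t ^ m))) summable_on UNIV"
    proof -
      have "norm (\<Sum>\<^sub>\<infinity>m. norm (C * s ^ j * t ^ m)) = (\<bar>C\<bar> * \<bar>\<Sum>\<^sub>\<infinity>m. t ^ m\<bar>) * s ^ j" for j
      proof -
        have "(\<Sum>\<^sub>\<infinity>m. norm (C * s ^ j * t ^ m)) = (\<Sum>\<^sub>\<infinity>m. (\<bar>C\<bar> * s ^ j) * t ^ m)"
          using st by (simp add: abs_mult)
        also have "\<dots> = (\<bar>C\<bar> * s ^ j) * (\<Sum>\<^sub>\<infinity>m. t ^ m)"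
          using geom by (intro infsum_cmult_right)
        finally show ?thesis
          using st by (simp add: abs_mult mult_ac)
      qed
      thus ?thesis
        by (simp only: summable_on_cmult_right[OF geom(2)])
    qed
    ultimately show ?thesis
      unfolding Infinite_Sum.abs_summable_on_Sigma_iff by simp
  qed
  have "(\<lambda>x. norm (case x of (j, m) \<Rightarrow> f j m)) summable_on UNIV \<times> UNIV"
    by (rule Infinite_Sum.abs_summable_on_comparison_test[OF bound_summable]) (clarsimp, intro order_trans[OF bound abs_ge_self[THEN order_trans]], simp)
  hence summ: "(\<lambda>(j, m). f j m) summable_on UNIV \<times> UNIV"
    by (rule abs_summable_summable)
  define S where "S = (\<Sum>\<^sub>\<infinity>(j, m)\<in>UNIV \<times> UNIV. f j m)"
  have S: "((\<lambda>(j, m). f j m) has_sum S) (UNIV \<times> UNIV)"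
    using summ by (simp add: S_def)
  have "(f j has_sum g j) UNIV" for j
  proof -
    have "summable (\<lambda>m. norm (f j m))"
    proof (rule summable_comparison_test'[of "\<lambda>m. C * s ^ j * t ^ m" 0])
      show "summable (\<lambda>m. C * s ^ j * t ^ m)"
        using st by (intro summable_mult summable_geometric) simp
    qed (simp add: bound)
    thus ?thesis
      using inner norm_summable_imp_has_sum by blast
  qed
  hence "(g has_sum S) UNIV"
    using has_sum_SigmaD[OF S, of g] by simp
  hence g: "g sums S"
    by (rule has_sum_imp_sums)
  have "((\<lambda>(n, j). f j (n - j)) has_sum S) (Sigma UNIV (\<lambda>n. {..n}))"
    using S
    by (subst has_sum_reindex_bij_witness[where i = "\<lambda>(j, m). (j + m, j)" and j = "\<lambda>(n, j). (j, n - j)" and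
          T = "UNIV \<times> UNIV" and h = "\<lambda>(j, m). f j m" and s' = S]) auto
  hence "((\<lambda>n. \<Sum>j\<le>n. f j (n - j)) has_sum S) UNIV"
    by (rule has_sum_SigmaD) (simp only: prod.case has_sum_finite finite_atMost)
  hence "(\<lambda>n. \<Sum>j\<le>n. f j (n - j)) sums S"
    by (rule has_sum_imp_sums)
  thus "summable g" "(\<lambda>n. \<Sum>j\<le>n. f j (n - j)) sums suminf g"
    using sums_summable[OF g] sums_unique[OF g] by simp_all
qed

section \<open>The base q, q-Pascal rules and finite q-Vandermonde sums\<close>

locale q_base =
  fixes q :: complex
  assumes q0: "q \<noteq> 0" and q1: "norm q < 1"
begin

lemma q_power_neq_1 [simp]: "q * q ^ n \<noteq> 1"
proof
  assume "q * q ^ n = 1"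
  hence "norm (q ^ Suc n) = 1"
    by simp
  thus False
    using q1 power_less_one_iff[of "norm q" "Suc n"] by (simp add: norm_power del: power_Suc)
qed

lemma qpoch_q_nz [simp]: "qpoch q q n \<noteq> 0"
  by (simp add: qpoch_def)

lemma qbin_0_right [simp]: "qbin q n 0 = 1"
  by (simp add: qbin_def)

lemma qbin_self [simp]: "qbin q n n = 1"
  by (simp add: qbin_def)

lemma qbin_gt: "k > n \<Longrightarrow> qbin q n k = 0"
  by (simp add: qbin_def)

lemma qbin_Suc_Suc: "qbin q (Suc n) (Suc k) = qbin q n k + q ^ Suc k * qbin q n (Suc k)"
proof (cases "k < n")
  case True
  then obtain i where n: "n = Suc (i + k)"
    by (metis less_imp_Suc_add add.commute)
  have eqs: "qbin q (Suc n) (Suc k) = qpoch q q (Suc (Suc (i + k))) / (qpoch q q (Suc k) * qpoch q q (Suc i))"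
    "qbin q n k = qpoch q q (Suc (i + k)) / (qpoch q q k * qpoch q q (Suc i))"
    "qbin q n (Suc k) = qpoch q q (Suc (i + k)) / (qpoch q q (Suc k) * qpoch q q i)"
    by (simp_all add: qbin_def n Suc_diff_le)
  show ?thesis
    unfolding eqs by (simp add: qpoch_Suc divide_simps power_add) algebra
qed (auto simp: not_less le_less qbin_gt)

text \<open>The companion Pascal rule, with the power of q on the other coefficient. It suits sums
  carrying \<open>qcoef\<close>, where q ^ (n - k) offsets the change of n inside q ^ (n *
  k).\<close>

lemma qbin_Suc_Suc': 
  assumes "k \<le> n"
  shows "qbin q (Suc n) (Suc k) = q ^ (n - k) * qbin q n k + qbin q n (Suc k)"
proof (cases "k < n")
  case True
  then obtain i where n: "n = Suc (i + k)"
    by (metis less_imp_Suc_add add.commute)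
  have eqs: "qbin q (Suc n) (Suc k) = qpoch q q (Suc (Suc (i + k))) / (qpoch q q (Suc k) * qpoch q q (Suc i))"
    "qbin q n k = qpoch q q (Suc (i + k)) / (qpoch q q k * qpoch q q (Suc i))"
    "qbin q n (Suc k) = qpoch q q (Suc (i + k)) / (qpoch q q (Suc k) * qpoch q q i)"
    "n - k = Suc i"
    by (simp_all add: qbin_def n Suc_diff_le)
  show ?thesis
    unfolding eqs by (simp add: qpoch_Suc divide_simps power_add) algebra
qed (use assms in \<open>auto simp: not_less le_less qbin_gt\<close>)

lemma sum_qbin_Suc:
  "(\<Sum>k\<le>Suc n. qbin q (Suc n) k * f k) = (\<Sum>k\<le>n. qbin q n k * (q ^ k * f k + f (Suc k)))"
proof -
  have "(\<Sum>k\<le>Suc n. qbin q (Suc n) k * f k) =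
        f 0 + (\<Sum>k\<le>n. q ^ Suc k * qbin q n (Suc k) * f (Suc k)) + (\<Sum>k\<le>n. qbin q n k * f (Suc k))"
    by (subst sum.atMost_Suc_shift) (simp add: qbin_Suc_Suc algebra_simps sum.distrib)
  also have "f 0 + (\<Sum>k\<le>n. q ^ Suc k * qbin q n (Suc k) * f (Suc k)) =
             (\<Sum>k\<le>Suc n. q ^ k * qbin q n k * f k)"
    by (subst sum.atMost_Suc_shift) simp
  also have "\<dots> = (\<Sum>k\<le>n. q ^ k * qbin q n k * f k)"
    by (simp add: qbin_gt)
  finally show ?thesis
    by (simp add: algebra_simps sum.distrib)
qed

lemma sum_qbin_Suc':
  "(\<Sum>k\<le>Suc n. qbin q (Suc n) k * f k) = (\<Sum>k\<le>n. qbin q n k * (f k + q ^ (n - k) * f (Suc k)))"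
proof -
  have "(\<Sum>k\<le>Suc n. qbin q (Suc n) k * f k) =
        f 0 + (\<Sum>k\<le>n. qbin q n (Suc k) * f (Suc k)) + (\<Sum>k\<le>n. q ^ (n - k) * qbin q n k * f (Suc k))"
    by (subst sum.atMost_Suc_shift) (simp add: qbin_Suc_Suc' algebra_simps sum.distrib)
  also have "f 0 + (\<Sum>k\<le>n. qbin q n (Suc k) * f (Suc k)) = (\<Sum>k\<le>Suc n. qbin q n k * f k)"
    by (subst sum.atMost_Suc_shift) simp
  also have "\<dots> = (\<Sum>k\<le>n. qbin q n k * f k)"
    by (simp add: qbin_gt)
  finally show ?thesis
    by (simp add: algebra_simps sum.distrib)
qed

lemma qbin_mult_qbin:
  assumes "j \<le> k" "k \<le> n"
  shows "qbin q n k * qbin q k j = qbin q n j * qbin q (n - j) (k - j)"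
proof -
  obtain i where i: "k = j + i"
    using assms le_Suc_ex by blast
  moreover obtain l where l: "n = j + i + l"
    using assms i le_Suc_ex by blast
  ultimately show ?thesis
    by (simp add: qbin_def)
qed

text \<open>The finite interchange behind \<open>phi32_transformation\<close>,
  \<open>terminating_expansion\<close> and \<open>phi43_expansion\<close>: a chain j \<le> k \<le> n
  can be chosen from either end.\<close>

lemma sum_qbin_qbin:
  "(\<Sum>k\<le>n. qbin q n k * (\<Sum>j\<le>k. qbin q k j * f j (k - j))) =
   (\<Sum>j\<le>n. qbin q n j * (\<Sum>i\<le>n - j. qbin q (n - j) i * f j i))"
proof -
  have "(\<Sum>k\<le>n. qbin q n k * (\<Sum>j\<le>k. qbin q k j * f j (k - j))) =
        (\<Sum>(k, j)\<in>Sigma {..n} (\<lambda>k. {..k}). qbin q n k * qbin q k j * f j (k - j))"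
    by (subst sum.Sigma[symmetric]) (simp_all add: sum_distrib_left mult.assoc)
  also have "\<dots> = (\<Sum>(j, i)\<in>Sigma {..n} (\<lambda>j. {..n - j}). qbin q n j * qbin q (n - j) i * f j i)"
    by (rule sum.reindex_bij_witness[where i = "\<lambda>(j, i). (j + i, j)" and j = "\<lambda>(k, j). (j, k - j)"])
       (auto simp: qbin_mult_qbin)
  also have "\<dots> = (\<Sum>j\<le>n. qbin q n j * (\<Sum>i\<le>n - j. qbin q (n - j) i * f j i))"
    by (subst sum.Sigma[symmetric]) (simp_all add: sum_distrib_left mult.assoc)
  finally show ?thesis .
qed

lemma q_vandermonde:
  "(\<Sum>k\<le>n. qbin q n k * (qpoch b q k * y ^ k * qpoch y q (n - k))) = qpoch (b * y) q n"
proof (induction n arbitrary: b y)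
  case (Suc n)
  have "(\<Sum>k\<le>Suc n. qbin q (Suc n) k * (qpoch b q k * y ^ k * qpoch y q (Suc n - k))) =
        (\<Sum>k\<le>n. qbin q n k * (q ^ k * (qpoch b q k * y ^ k * qpoch y q (Suc (n - k))) +
           qpoch b q (Suc k) * y ^ Suc k * qpoch y q (n - k)))"
    by (subst sum_qbin_Suc) (simp add: Suc_diff_le)
  \<comment> \<open>Peeling off first factors leaves the same sum at (b, y q) and at (b q, y); both
    equal (b y q; q)_n, and the coefficients add up to 1 - b y.\<close>
  also have "\<dots> = (1 - y) * (\<Sum>k\<le>n. qbin q n k * (qpoch b q k * (y * q) ^ k * qpoch (y * q) q (n - k))) +
                  y * (1 - b) * (\<Sum>k\<le>n. qbin q n k * (qpoch (b * q) q k * y ^ k * qpoch y q (n - k)))"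
    by (simp add: qpoch_Suc_shift sum_distrib_left sum.distrib[symmetric] power_mult_distrib algebra_simps)
  also have "\<dots> = qpoch (b * y) q (Suc n)"
    by (simp only: Suc.IH) (simp add: qpoch_Suc_shift algebra_simps)
  finally show ?case .
qed auto

lemma hpoch_shift_scale: "q ^ n * hpoch x y q n = hpoch (x * q) (y * q) q n"
  using hpoch_scale[of q x y q n] by (simp add: mult.commute)

text \<open>The q-Chu--Vandermonde sum for 2phi1(q^-k, A/p; A; q, p q^k); the power p^i is absorbed
  into \<open>hpoch\<close>, so p = 0 is covered.\<close>

lemma qpoch_ratio_expansion:
  assumes "\<And>k. 1 - A * q ^ k \<noteq> 0"
  shows "(\<Sum>i\<le>k. qbin q k i * (qsgn q i * (hpoch p A q i / qpoch A q i))) = qpoch p q k / qpoch A q k"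
  using assms
proof (induction k arbitrary: p A)
  case (Suc k)
  have A: "1 - A \<noteq> 0" and Aq: "1 - A * q * q ^ k \<noteq> 0" for k
    using Suc.prems[of 0] Suc.prems[of "Suc k"] by (simp_all add: mult.assoc)
  have nz: "qpoch (A * q) q i \<noteq> 0" for i
    using Aq by (simp add: qpoch_def)
  \<comment> \<open>The sign in \<open>qsgn_Suc\<close> turns the Pascal split into a difference of
    neighbouring terms, which is again a summand of the same kind at (p q, A q).\<close>
  have *: "q ^ i * (hpoch p A q i / qpoch A q i) - q ^ i * (hpoch p A q (Suc i) / qpoch A q (Suc i)) =
     (1 - p) / (1 - A) * (hpoch (p * q) (A * q) q i / qpoch (A * q) q i)" for i
  proof -
    have "1 - A * q ^ i \<noteq> 0" "qpoch A q i \<noteq> 0"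
      using Suc.prems by (auto simp: qpoch_def)
    hence "hpoch p A q i / qpoch A q i - hpoch p A q (Suc i) / qpoch A q (Suc i) =
          hpoch p A q i * (1 - p) / qpoch A q (Suc i)"
      by (simp add: hpoch_Suc qpoch_Suc divide_simps) algebra
    hence "q ^ i * (hpoch p A q i / qpoch A q i) - q ^ i * (hpoch p A q (Suc i) / qpoch A q (Suc i)) =
        (q ^ i * hpoch p A q i) * (1 - p) / qpoch A q (Suc i)"
      by (simp only: right_diff_distrib[symmetric]) (simp add: mult.assoc)
    thus ?thesis
      using A nz by (simp add: hpoch_shift_scale qpoch_Suc_shift)
  qed
  have "(\<Sum>i\<le>Suc k. qbin q (Suc k) i * (qsgn q i * (hpoch p A q i / qpoch A q i))) =
        (\<Sum>i\<le>k. qbin q k i * (qsgn q i * (q ^ i * (hpoch p A q i / qpoch A q i) -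
            q ^ i * (hpoch p A q (Suc i) / qpoch A q (Suc i)))))"
    by (subst sum_qbin_Suc) (simp add: qsgn_Suc algebra_simps)
  also have "\<dots> = (1 - p) / (1 - A) *
      (\<Sum>i\<le>k. qbin q k i * (qsgn q i * (hpoch (p * q) (A * q) q i / qpoch (A * q) q i)))"
    by (simp only: *) (simp add: sum_distrib_left mult_ac)
  also have "\<dots> = qpoch p q (Suc k) / qpoch A q (Suc k)"
    by (subst Suc.IH) (use Aq in \<open>simp_all add: qpoch_Suc_shift\<close>)
  finally show ?case .
qed auto

text \<open>The quotient \<open>(q^-n; q)_k q^k / (q; q)_k\<close> occurring in a terminating series equals
  \<open>qbin q n k * qcoef n k\<close>; see \<open>qpoch_inverse_power\<close>.\<close>

definition qcoef :: "nat \<Rightarrow> nat \<Rightarrow> complex" where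
  "qcoef n k = qsgn q k * q ^ k / q ^ (n * k)"

text \<open>The companion evaluation at argument q, of 2phi1(q^-n, b; B; q, q), with b^n absorbed
  into \<open>hpoch\<close>.\<close>

lemma q_chu_vandermonde:
  assumes "\<And>k. 1 - B * q ^ k \<noteq> 0"
  shows "(\<Sum>k\<le>n. qbin q n k * (qcoef n k * (qpoch b q k / qpoch B q k))) = hpoch b B q n / qpoch B q n"
  using assms
proof (induction n arbitrary: B)
  case (Suc n)
  have B: "1 - B \<noteq> 0" and Bq: "1 - B * q * q ^ k \<noteq> 0" for k
    using Suc.prems[of 0] Suc.prems[of "Suc k"] by (simp_all add: mult.assoc)
  have nz: "qpoch (B * q) q i \<noteq> 0" for i
    using Bq by (simp add: qpoch_def)
  \<comment> \<open>Again a difference of neighbouring terms, but here only B moves to B q while b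
    stays fixed.\<close>
  have *: "qcoef (Suc n) i * (qpoch b q i / qpoch B q i) +
        q ^ (n - i) * (qcoef (Suc n) (Suc i) * (qpoch b q (Suc i) / qpoch B q (Suc i))) =
     (b - B) / (1 - B) * (qcoef n i * (qpoch b q i / qpoch (B * q) q i))" if i: "i \<le> n" for i
  proof -
    obtain l where n: "n = i + l" using i le_Suc_ex by blast
    have nzi: "1 - B * q ^ i \<noteq> 0" "qpoch B q i \<noteq> 0"
      using Suc.prems by (auto simp: qpoch_def)
    have "qcoef (Suc n) i = qcoef n i / q ^ i"
      using q0 by (simp add: qcoef_def power_add)
    moreover have "q ^ (n - i) * qcoef (Suc n) (Suc i) = - (qcoef n i / q ^ i)"
      using q0 by (simp add: qcoef_def qsgn_Suc power_add n field_simps)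
    ultimately have "qcoef (Suc n) i * (qpoch b q i / qpoch B q i) +
        q ^ (n - i) * (qcoef (Suc n) (Suc i) * (qpoch b q (Suc i) / qpoch B q (Suc i))) =
        qcoef n i / q ^ i * (qpoch b q i / qpoch B q i - qpoch b q (Suc i) / qpoch B q (Suc i))"
      by (simp only: mult.assoc[symmetric]) (simp only: right_diff_distrib mult_minus_left add_uminus_conv_diff)
    also have "qpoch b q i / qpoch B q i - qpoch b q (Suc i) / qpoch B q (Suc i) =
        q ^ i * (qpoch b q i * (b - B) / qpoch B q (Suc i))"
      using nzi by (simp add: qpoch_Suc divide_simps) algebra
    finally show ?thesis
      using B nz q0 by (simp add: qpoch_Suc_shift)
  qed
  have "(\<Sum>k\<le>Suc n. qbin q (Suc n) k * (qcoef (Suc n) k * (qpoch b q k / qpoch B q k))) =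
        (\<Sum>i\<le>n. qbin q n i * ((b - B) / (1 - B) * (qcoef n i * (qpoch b q i / qpoch (B * q) q i))))"
    by (subst sum_qbin_Suc') (intro sum.cong refl arg_cong2[of _ _ _ _ "(*)"] *, simp)
  also have "\<dots> = (b - B) / (1 - B) * (\<Sum>i\<le>n. qbin q n i * (qcoef n i * (qpoch b q i / qpoch (B * q) q i)))"
    by (simp add: sum_distrib_left mult_ac)
  also have "\<dots> = hpoch b B q (Suc n) / qpoch B q (Suc n)"
    by (subst Suc.IH) (use Bq in \<open>simp_all add: qpoch_Suc_shift hpoch_Suc_shift\<close>)
  finally show ?case .
qed (auto simp: qcoef_def)

section \<open>Infinite products: convergence, bounds and holomorphy\<close>

lemma norm_q_pos: "norm q > 0"
  using q0 by simp

lemma summable_norm_q: "summable (\<lambda>k. norm q ^ k)"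
  using q1 by (simp add: summable_geometric)

lemma sum_norm_q_le: "(\<Sum>k<n. norm q ^ k) \<le> 1 / (1 - norm q)"
  using sum_le_suminf[OF summable_norm_q, of "{..<n}"] q1 by (simp add: suminf_geometric)

lemma abs_convergent_prod_qpoch: "abs_convergent_prod (\<lambda>k. 1 - x * q ^ k)"
proof (rule summable_imp_abs_convergent_prod)
  show "summable (\<lambda>k. norm (1 - x * q ^ k - 1))"
    using summable_mult[OF summable_norm_q, of "norm x"] by (simp add: norm_mult norm_power)
qed

lemma has_prod_qpoch_inf: "(\<lambda>k. 1 - x * q ^ k) has_prod qpoch_inf x q"
  unfolding qpoch_inf_def
  using abs_convergent_prod_qpoch[THEN abs_convergent_prod_imp_convergent_prod] by blast

lemma qpoch_LIMSEQ: "(\<lambda>n. qpoch x q n) \<longlonglongrightarrow> qpoch_inf x q"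
  unfolding qpoch_def by (rule has_prod_imp_tendsto'[OF has_prod_qpoch_inf])

lemma qpoch_inf_eq_0_iff: "qpoch_inf x q = 0 \<longleftrightarrow> (\<exists>k. 1 - x * q ^ k = 0)"
  using has_prod_eq_0_iff[OF has_prod_qpoch_inf] by auto

lemma qpoch_inf_split: "qpoch_inf x q = qpoch x q n * qpoch_inf (x * q ^ n) q"
proof (rule LIMSEQ_unique)
  show "(\<lambda>m. qpoch x q (n + m)) \<longlonglongrightarrow> qpoch_inf x q"
    using LIMSEQ_ignore_initial_segment[OF qpoch_LIMSEQ, of x n] by (simp add: add.commute)
  show "(\<lambda>m. qpoch x q (n + m)) \<longlonglongrightarrow> qpoch x q n * qpoch_inf (x * q ^ n) q"
    unfolding qpoch_add by (intro tendsto_intros qpoch_LIMSEQ)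
qed

lemma qpoch_inf_Suc: "qpoch_inf x q = (1 - x) * qpoch_inf (x * q) q"
  using qpoch_inf_split[of x 1] by (simp add: qpoch_Suc)

text \<open>Each factor is at most r (1 + (Y/r) |q|^k) \<le> r exp((Y/r) |q|^k), and the exponents
  form a geometric series. Separating r from |x| covers x = 0 and leaves the growth rate free to
  choose.\<close>

lemma norm_hpoch_le:
  assumes "norm x \<le> r" "r > 0" "norm y \<le> Y"
  shows "norm (hpoch x y q n) \<le> exp (Y / (r * (1 - norm q))) * r ^ n"
proof -
  have Y: "Y \<ge> 0"
    using assms(3) norm_ge_zero order_trans by blast
  have "norm (hpoch x y q n) \<le> (\<Prod>k<n. r * exp (Y / r * norm q ^ k))"
    unfolding hpoch_def prod_norm[symmetric]
  proof (intro prod_mono conjI norm_ge_zero)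
    fix k
    have "norm (x - y * q ^ k) \<le> norm x + norm y * norm q ^ k"
      by (metis norm_triangle_ineq4 norm_mult norm_power)
    also have "\<dots> \<le> r + Y * norm q ^ k"
      by (intro add_mono mult_right_mono assms) auto
    also have "\<dots> = r * (1 + Y / r * norm q ^ k)"
      using assms(2) by (simp add: field_simps)
    also have "\<dots> \<le> r * exp (Y / r * norm q ^ k)"
      using assms(2) by (intro mult_left_mono exp_ge_add_one_self) auto
    finally show "norm (x - y * q ^ k) \<le> r * exp (Y / r * norm q ^ k)" .
  qed
  also have "\<dots> = r ^ n * exp (Y / r * (\<Sum>k<n. norm q ^ k))"
    by (simp add: prod.distrib exp_sum sum_distrib_left)
  also have "\<dots> \<le> r ^ n * exp (Y / r * (1 / (1 - norm q)))"
    using assms Y sum_norm_q_le[of n]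
    by (intro mult_left_mono iffD2[OF exp_le_cancel_iff]) auto
  finally show ?thesis
    by (simp add: mult_ac)
qed

lemma norm_qpoch_le:
  assumes "norm x \<le> X"
  shows "norm (qpoch x q n) \<le> exp (X / (1 - norm q))"
  using norm_hpoch_le[of 1 1 x X n] assms by (simp add: qpoch_conv_hpoch)

lemma norm_qpoch_inf_le:
  assumes "norm x \<le> X"
  shows "norm (qpoch_inf x q) \<le> exp (X / (1 - norm q))"
  by (rule LIMSEQ_le_const2[OF tendsto_norm[OF qpoch_LIMSEQ]]) (use norm_qpoch_le[OF assms] in auto)

lemma inverse_qpoch_bounded:
  assumes "qpoch_inf x q \<noteq> 0"
  obtains M where "M > 0" "\<And>n. norm (inverse (qpoch x q n)) \<le> M"
proof -
  have "Bseq (\<lambda>n. inverse (qpoch x q n))"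
    by (rule convergent_imp_Bseq[OF convergentI[OF tendsto_inverse[OF qpoch_LIMSEQ assms]]])
  thus ?thesis
    using that by (auto simp: Bseq_def)
qed

lemma holomorphic_qpoch_inf: "(\<lambda>x. qpoch_inf x q) holomorphic_on UNIV"
proof (rule holomorphic_uniform_sequence)
  show "(\<lambda>x. qpoch x q n) holomorphic_on UNIV" for n
    unfolding qpoch_def by (intro holomorphic_intros)
next
  fix x :: complex
  have "uniformly_convergent_on (cball x 1) (\<lambda>n x. \<Prod>k<n. 1 - x * q ^ k)"
  proof (rule Complex_Transcendental.uniformly_convergent_on_prod')
    show "uniformly_convergent_on (cball x 1) (\<lambda>N x. \<Sum>n<N. norm (1 - x * q ^ n - 1))"
    proof (rule Weierstrass_m_test')
      show "summable (\<lambda>n. (norm x + 1) * norm q ^ n)"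
        by (intro summable_mult summable_norm_q)
      fix n y assume "y \<in> cball x 1"
      hence "norm y \<le> norm x + 1"
        by (metis mem_cball dist_norm norm_minus_commute norm_triangle_sub order_trans add_left_mono)
      thus "norm (norm (1 - y * q ^ n - 1)) \<le> (norm x + 1) * norm q ^ n"
        by (simp add: norm_mult norm_power mult_right_mono)
    qed
  qed (auto intro!: continuous_intros)
  then obtain l where l: "uniform_limit (cball x 1) (\<lambda>n x. qpoch x q n) l sequentially"
    by (auto simp: uniformly_convergent_on_def qpoch_def)
  have "l y = qpoch_inf y q" if "y \<in> cball x 1" for y
    using tendsto_uniform_limitI[OF l that] qpoch_LIMSEQ LIMSEQ_unique by blast
  hence "uniform_limit (cball x 1) (\<lambda>n x. qpoch x q n) (\<lambda>x. qpoch_inf x q) sequentially"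
    using l by (subst uniform_limit_cong'[where g = "\<lambda>n x. qpoch x q n" and i = l]) auto
  thus "\<exists>d>0. cball x d \<subseteq> UNIV \<and> uniform_limit (cball x d) (\<lambda>n x. qpoch x q n) (\<lambda>x. qpoch_inf x q) sequentially"
    by (intro exI[of _ 1]) auto
qed auto

lemma holomorphic_qpoch_inf' [holomorphic_intros]:
  assumes "f holomorphic_on S"
  shows "(\<lambda>x. qpoch_inf (f x) q) holomorphic_on S"
  using holomorphic_on_compose_gen[OF assms holomorphic_qpoch_inf] by (simp add: o_def)

section \<open>The terminating 3phi2 and its cancellation-free form\<close>

text \<open>The series 3phi2(q^-n, p, b; A, B; q, q); it is used with p = \<alpha> q^n.\<close>

definition phi32 :: "complex \<Rightarrow> complex \<Rightarrow> complex \<Rightarrow> complex \<Rightarrow> nat \<Rightarrow> complex" where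
  "phi32 p b A B n = (\<Sum>k\<le>n. qbin q n k * (qcoef n k * (qpoch p q k * qpoch b q k / (qpoch A q k * qpoch B q k))))"

text \<open>Shifting the summation index by i leaves the coefficient of a series of length m, and
  only a power linear in m survives.\<close>

lemma qcoef_add: "qcoef (m + i) (i + l) * qsgn q i = qcoef m l / q ^ (m * i)"
proof -
  have "qcoef (m + i) (i + l) * qsgn q i =
        (qsgn q i * qsgn q i * q ^ i) * qsgn q l * q ^ (i * l) * q ^ l / q ^ ((m + i) * (i + l))"
    by (simp add: qcoef_def qsgn_add power_add)
  also have "\<dots> = qcoef m l / q ^ (m * i)"
    unfolding qsgn_square using q0 by (simp add: qcoef_def power_add algebra_simps)
  finally show ?thesis .
qed

text \<open>Expanding (p; q)_k / (A; q)_k by \<open>qpoch_ratio_expansion\<close> and interchanging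
  leaves \<open>q_chu_vandermonde\<close> inside. The result contains no negative powers of q, which
  is what makes \<open>phi32_bound\<close> possible.\<close>

lemma phi32_transformation:
  assumes A: "\<And>k. 1 - A * q ^ k \<noteq> 0" and B: "\<And>k. 1 - B * q ^ k \<noteq> 0"
  shows "phi32 p b A B n = (\<Sum>i\<le>n. qbin q n i * (qpoch b q i / qpoch A q i * hpoch p A q i * hpoch b B q (n - i))) / qpoch B q n"
proof -
  have Bnz: "qpoch B q k \<noteq> 0" for k
    using B by (simp add: qpoch_def)
  define f where "f i l = hpoch p A q i / qpoch A q i * (qsgn q i * qcoef n (i + l) *
      (qpoch b q (i + l) / qpoch B q (i + l)))" for i l
  have "phi32 p b A B n = (\<Sum>k\<le>n. qbin q n k * (qcoef n k * (qpoch b q k / qpoch B q k *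
      (\<Sum>i\<le>k. qbin q k i * (qsgn q i * (hpoch p A q i / qpoch A q i))))))"
    unfolding phi32_def qpoch_ratio_expansion[OF A] by (simp add: mult_ac)
  also have "\<dots> = (\<Sum>k\<le>n. qbin q n k * (\<Sum>i\<le>k. qbin q k i * f i (k - i)))"
    by (simp add: f_def sum_distrib_left mult_ac)
  also have "\<dots> = (\<Sum>i\<le>n. qbin q n i * (\<Sum>l\<le>n - i. qbin q (n - i) l * f i l))"
    by (rule sum_qbin_qbin)
  also have "\<dots> = (\<Sum>i\<le>n. qbin q n i * (qpoch b q i / qpoch A q i * hpoch p A q i * hpoch b B q (n - i) / qpoch B q n))"
  proof (intro sum.cong refl arg_cong2[of _ _ _ _ "(*)"])
    fix i assume "i \<in> {..n}"
    then obtain m where n: "n = m + i"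
      by (metis atMost_iff le_iff_add add.commute)
    have Bi: "1 - B * q ^ i * q ^ k \<noteq> 0" for k
      using B[of "i + k"] by (simp add: power_add mult.assoc)
    have "(\<Sum>l\<le>n - i. qbin q (n - i) l * f i l) =
        hpoch p A q i / qpoch A q i * (qpoch b q i / qpoch B q i) / q ^ (m * i) *
        (\<Sum>l\<le>m. qbin q m l * (qcoef m l * (qpoch (b * q ^ i) q l / qpoch (B * q ^ i) q l)))"
      unfolding sum_distrib_left
    proof (intro sum.cong)
      fix l
      have "qsgn q i * qcoef n (i + l) = qcoef m l / q ^ (m * i)"
        using qcoef_add[of m i l] by (simp add: n mult.commute)
      thus "qbin q (n - i) l * f i l = hpoch p A q i / qpoch A q i * (qpoch b q i / qpoch B q i) / q ^ (m * i) *
          (qbin q m l * (qcoef m l * (qpoch (b * q ^ i) q l / qpoch (B * q ^ i) q l)))"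
        by (simp add: f_def qpoch_add n mult_ac)
    qed (simp add: n)
    \<comment> \<open>Homogeneity of \<open>hpoch\<close> in (b q^i, B q^i) produces q ^ (m * i),
      cancelling the last negative power exactly.\<close>
    also have "\<dots> = hpoch p A q i / qpoch A q i * (qpoch b q i / qpoch B q i) / q ^ (m * i) *
        (q ^ (m * i) * hpoch b B q m / qpoch (B * q ^ i) q m)"
      using hpoch_scale[of "q ^ i" b B q m]
      by (subst q_chu_vandermonde[OF Bi]) (simp add: mult.commute power_mult[symmetric])
    also have "\<dots> = qpoch b q i / qpoch A q i * hpoch p A q i * hpoch b B q (n - i) / qpoch B q n"
      using q0 by (simp add: n add.commute[of m] qpoch_add mult_ac)
    finally show "(\<Sum>l\<le>n - i. qbin q (n - i) l * f i l) = \<dots>" .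
  qed
  finally show ?thesis
    by (simp add: sum_divide_distrib)
qed

section \<open>Very-well-poised weights and the terminating identity\<close>

text \<open>The very-well-poised weight with \<open>A = q/a\<close>, \<open>B = q/b\<close> and \<open>y = \<alpha>ab/q\<close>, so that
  \<open>\<alpha>b = yA\<close>, \<open>\<alpha>a = yB\<close> and \<open>\<alpha>q = yAB\<close>. In these parameters \<open>A\<close>, \<open>B\<close> are allowed to vanish,
  and the shift \<open>(\<alpha>, A, B) \<mapsto> (\<alpha>q^2k, Aq^k, Bq^k)\<close> leaves \<open>y\<close> fixed.\<close>

definition vwp :: "complex \<Rightarrow> complex \<Rightarrow> complex \<Rightarrow> complex \<Rightarrow> nat \<Rightarrow> complex" where
  "vwp \<alpha> A B y n = (1 - \<alpha> * q ^ (2 * n)) * qpoch \<alpha> q n * qpoch A q n * qpoch B q n /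
      (qpoch (y * A) q n * qpoch (y * B) q n) * y ^ n"

text \<open>Rogers' sum with numerator parameters \<alpha>, A, B, q^-N, multiplied by (1 - \<alpha>)
  (\<alpha> q^(N+1); q)_\<infinity>: the denominator (\<alpha> q^(N+1); q)_n becomes a tail product
  in the numerator, so no \<alpha> gives a pole. Raising N by 1 multiplies both sides by (1 - y q^N)
  / ((1 - y A q^N) (1 - y B q^N)).\<close>

lemma terminating_6phi5:
  assumes rel: "\<alpha> * q = y * A * B"
    and yA: "\<And>k. 1 - y * A * q ^ k \<noteq> 0" and yB: "\<And>k. 1 - y * B * q ^ k \<noteq> 0"
  shows "(\<Sum>n\<le>N. qbin q N n * (qsgn q n * vwp \<alpha> A B y n * qpoch_inf (\<alpha> * q ^ (N + 1 + n)) q)) =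
         qpoch_inf \<alpha> q * qpoch y q N / (qpoch (y * A) q N * qpoch (y * B) q N)"
proof (induction N)
  case 0
  show ?case
    using qpoch_inf_Suc[of \<alpha>] by (simp add: vwp_def)
next
  case (Suc N)
  define t where "t N n = qbin q N n * (qsgn q n * vwp \<alpha> A B y n * qpoch_inf (\<alpha> * q ^ (N + 1 + n)) q)" for N n
  txt \<open>\<open>h\<close> is the antidifference in \<open>n\<close> given by the q-WZ certificate of the recurrence in \<open>N\<close>.\<close>
  define h where "h n = qbin q N n * qsgn q n * (qpoch \<alpha> q (Suc n) * qpoch A q (Suc n) * qpoch B q (Suc n)) /
      (qpoch (y * A) q n * qpoch (y * B) q n) * y ^ Suc n * q ^ N * qpoch_inf (\<alpha> * q ^ (N + 2 + n)) q" for n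
  have nzA: "qpoch (y * A) q n \<noteq> 0" and nzB: "qpoch (y * B) q n \<noteq> 0" for n
    using yA yB by (simp_all add: qpoch_def)
  have inf_step: "qpoch_inf (\<alpha> * q ^ n) q = (1 - \<alpha> * q ^ n) * qpoch_inf (\<alpha> * q ^ Suc n) q" for n
    using qpoch_inf_Suc[of "\<alpha> * q ^ n"] by (simp add: mult_ac)
  \<comment> \<open>At M = N + 1 the right-hand side vanishes because
    \<open>qbin q N (Suc N)\<close> is 0, and this is the recurrence in N.\<close>
  have telescope: "(\<Sum>n\<le>M. (1 - y * A * q ^ N) * (1 - y * B * q ^ N) * t (Suc N) n - (1 - y * q ^ N) * t N n) = h M"
    if "M \<le> Suc N" for M
    using that
  proof (induction M)
    case 0
    define E where "E = qpoch_inf (\<alpha> * q ^ (N + 2)) q"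
    have t0: "t (Suc N) 0 = (1 - \<alpha>) * E" "t N 0 = (1 - \<alpha>) * ((1 - \<alpha> * q * q ^ N) * E)"
      using inf_step[of "N + 1"] by (simp_all add: t_def vwp_def E_def mult_ac)
    have h0: "h 0 = (1 - A) * (1 - B) * y * q ^ N * ((1 - \<alpha>) * E)"
      by (simp add: h_def qpoch_Suc E_def)
    have "(1 - y * A * q ^ N) * (1 - y * B * q ^ N) * ((1 - \<alpha>) * E) -
          (1 - y * q ^ N) * ((1 - \<alpha>) * ((1 - \<alpha> * q * q ^ N) * E)) = h 0"
      unfolding h0 rel by algebra
    thus ?case
      by (simp add: t0)
  next
    case (Suc m)
    then obtain l where N: "N = m + l"
      using le_Suc_ex by auto
    \<comment> \<open>In z = q^m and v = q^l the neighbouring terms of t and h all become U times a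
      polynomial, so the step reduces to a polynomial identity modulo \<open>rel\<close>.\<close>
    define z v where "z = q ^ m" and "v = q ^ l"
    define w where "w = qpoch q q N / (qpoch q q (Suc m) * qpoch q q l)"
    define E where "E = qpoch_inf (\<alpha> * q ^ (N + 3 + m)) q"
    define U where "U = w * qsgn q m * (qpoch \<alpha> q (Suc m) * qpoch A q (Suc m) * qpoch B q (Suc m)) /
       (qpoch (y * A) q (Suc m) * qpoch (y * B) q (Suc m)) * y ^ Suc m * E"
    have Nz: "q ^ N = z * v"
      by (simp add: z_def v_def N power_add)
    have b1: "qbin q (Suc N) (Suc m) = w * (1 - q * (z * v))"
      by (simp add: qbin_def N w_def qpoch_Suc z_def v_def power_add)
    have b2: "qbin q N m = w * (1 - q * z)"
      by (simp add: qbin_def N w_def qpoch_Suc z_def v_def power_add divide_simps)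
    \<comment> \<open>For l = 0 the index exceeds N, and the factor 1 - v vanishes
      accordingly.\<close>
    have b3: "qbin q N (Suc m) = w * (1 - v)"
    proof (cases l)
      case (Suc k)
      thus ?thesis by (simp add: qbin_def N w_def qpoch_Suc v_def power_add divide_simps)
    qed (simp add: N qbin_gt v_def)
    have E': "qpoch_inf (\<alpha> * q ^ (N + 2 + m)) q = (1 - \<alpha> * q * q * (z * v * z)) * E"
      using inf_step[of "N + 2 + m"] by (simp add: E_def N z_def v_def power_add mult_ac eval_nat_numeral)
    have t1: "t (Suc N) (Suc m) = U * ((1 - q * (z * v)) * (-z) * (1 - \<alpha> * q * q * (z * z)))"
      unfolding t_def b1 by (simp add: vwp_def U_def E_def qsgn_Suc z_def power_add mult_ac power_mult power2_eq_square power_mult_distrib eval_nat_numeral)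
    have t2: "t N (Suc m) = U * ((1 - v) * (-z) * (1 - \<alpha> * q * q * (z * z)) * (1 - \<alpha> * q * q * (z * v * z)))"
      unfolding t_def b3 using E' by (simp add: vwp_def U_def qsgn_Suc z_def power_add mult_ac power_mult power2_eq_square power_mult_distrib eval_nat_numeral)
    have h1: "h (Suc m) = U * ((1 - v) * (-z) * (1 - \<alpha> * q * z) * (1 - A * q * z) * (1 - B * q * z) * y * (z * v))"
      unfolding h_def b3 Nz by (simp add: U_def E_def qsgn_Suc qpoch_Suc[of _ _ "Suc m"] z_def mult_ac eval_nat_numeral)
    have h2: "h m = U * ((1 - q * z) * (1 - y * A * z) * (1 - y * B * z) * (z * v) * (1 - \<alpha> * q * q * (z * v * z)))"
      unfolding h_def b2 Nz E' using yA[of m] yB[of m] 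
      by (simp add: U_def qpoch_Suc[of "y * A"] qpoch_Suc[of "y * B"] z_def)
    have "(1 - y * A * (z * v)) * (1 - y * B * (z * v)) * ((1 - q * (z * v)) * (-z) * (1 - \<alpha> * q * q * (z * z))) -
          (1 - y * (z * v)) * ((1 - v) * (-z) * (1 - \<alpha> * q * q * (z * z)) * (1 - \<alpha> * q * q * (z * v * z))) =
          ((1 - v) * (-z) * (1 - \<alpha> * q * z) * (1 - A * q * z) * (1 - B * q * z) * y * (z * v)) -
          ((1 - q * z) * (1 - y * A * z) * (1 - y * B * z) * (z * v) * (1 - \<alpha> * q * q * (z * v * z)))"
      unfolding rel by algebra
    from arg_cong[OF this, of "\<lambda>x. U * x"]
    have "(1 - y * A * q ^ N) * (1 - y * B * q ^ N) * t (Suc N) (Suc m) - (1 - y * q ^ N) * t N (Suc m) = h (Suc m) - h m"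
      unfolding t1 t2 h1 h2 Nz by (simp only: right_diff_distrib mult_ac)
    thus ?case
      using Suc by simp
  qed
  have "(1 - y * A * q ^ N) * (1 - y * B * q ^ N) * (\<Sum>n\<le>Suc N. t (Suc N) n) - (1 - y * q ^ N) * (\<Sum>n\<le>N. t N n) = 0"
  proof -
    have "(\<Sum>n\<le>N. t N n) = (\<Sum>n\<le>Suc N. t N n)" "h (Suc N) = 0"
      by (simp_all add: t_def h_def qbin_gt)
    thus ?thesis
      using telescope[of "Suc N"] by (simp only: sum_subtractf sum_distrib_left)
  qed
  hence "(\<Sum>n\<le>Suc N. t (Suc N) n) * ((1 - y * A * q ^ N) * (1 - y * B * q ^ N)) =
      (1 - y * q ^ N) * (qpoch_inf \<alpha> q * qpoch y q N / (qpoch (y * A) q N * qpoch (y * B) q N))"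
    unfolding Suc.IH[folded t_def] by (simp only: mult.commute right_minus_eq)
  hence "(\<Sum>n\<le>Suc N. t (Suc N) n) = (1 - y * q ^ N) * (qpoch_inf \<alpha> q * qpoch y q N /
      (qpoch (y * A) q N * qpoch (y * B) q N)) / ((1 - y * A * q ^ N) * (1 - y * B * q ^ N))"
    using yA[of N] yB[of N] by (simp only: nonzero_eq_divide_eq mult_eq_0_iff simp_thms)
  hence "(\<Sum>n\<le>Suc N. t (Suc N) n) = qpoch_inf \<alpha> q * qpoch y q (Suc N) / (qpoch (y * A) q (Suc N) * qpoch (y * B) q (Suc N))"
    by (simp add: qpoch_Suc mult_ac del: sum.atMost_Suc)
  thus ?case
    by (simp only: t_def)
qed

text \<open>The extra factor extends (\<alpha>; q)_(k+m) to (\<alpha>; q)_(2k+m), which splits at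
  2k; this is the origin of the new base \<alpha> q^(2k).\<close>

lemma vwp_shift:
  assumes "qpoch A q k \<noteq> 0" "qpoch B q k \<noteq> 0"
  shows "vwp \<alpha> A B y (k + m) * (qpoch (\<alpha> * q ^ (k + m)) q k / (qpoch A q k * qpoch B q k)) =
    qpoch \<alpha> q (2 * k) * y ^ k / (qpoch (y * A) q k * qpoch (y * B) q k) *
    vwp (\<alpha> * q ^ (2 * k)) (A * q ^ k) (B * q ^ k) y m"
proof -
  have "qpoch \<alpha> q (k + m) * qpoch (\<alpha> * q ^ (k + m)) q k = qpoch \<alpha> q (2 * k) * qpoch (\<alpha> * q ^ (2 * k)) q m"
    by (simp add: qpoch_add[symmetric] mult_2 add_ac)
  moreover have "\<alpha> * q ^ (2 * (k + m)) = \<alpha> * q ^ (2 * k) * q ^ (2 * m)"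
    by (simp add: power_add)
  ultimately show ?thesis
    using assms
    by (simp add: vwp_def qpoch_add[of A] qpoch_add[of B] qpoch_add[of "y * A"] qpoch_add[of "y * B"]
        power_add mult.assoc[symmetric]) (simp add: mult_ac)
qed

text \<open>The negative powers of the inner series cancel completely against the outer sign factor,
  leaving the sign factor of the remaining sum over m = n - k.\<close>

lemma qsgn_qcoef: "qsgn q (k + m) * qcoef (k + m) k = qsgn q m"
proof -
  have "qsgn q (k + m) * qcoef (k + m) k = (qsgn q k * qsgn q k * q ^ k) * qsgn q m * q ^ (k * m) / q ^ ((k + m) * k)"
    by (simp add: qcoef_def qsgn_add)
  thus ?thesis
    unfolding qsgn_square using q0 by (simp add: power_add algebra_simps)
qed

lemma one_minus_shift_nz:
  assumes "\<And>k. 1 - x * q ^ k \<noteq> 0"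
  shows "1 - x * q ^ j * q ^ k \<noteq> 0"
  using assms[of "j + k"] by (simp add: power_add mult.assoc)

text \<open>This is \<open>gterm_sums\<close> at d = q^N. The weights of
  \<open>q_vandermonde\<close> arise because the shift keeps y fixed: \<open>vwp_shift\<close>
  supplies y^k and the 6phi5 sum supplies (y; q)_(N-k).\<close>

lemma terminating_expansion:
  assumes rel: "\<alpha> * q = y * A * B"
    and A: "\<And>k. 1 - A * q ^ k \<noteq> 0" and B: "\<And>k. 1 - B * q ^ k \<noteq> 0"
    and yA: "\<And>k. 1 - y * A * q ^ k \<noteq> 0" and yB: "\<And>k. 1 - y * B * q ^ k \<noteq> 0"
  shows "(\<Sum>n\<le>N. qbin q N n * (qsgn q n * vwp \<alpha> A B y n * qpoch_inf (\<alpha> * q ^ (N + 1 + n)) q * phi32 (\<alpha> * q ^ n) b A B n)) =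
         qpoch_inf \<alpha> q * qpoch (b * y) q N / (qpoch (y * A) q N * qpoch (y * B) q N)"
proof -
  have nz: "qpoch A q n \<noteq> 0" "qpoch B q n \<noteq> 0" "qpoch (y * A) q n \<noteq> 0" "qpoch (y * B) q n \<noteq> 0" for n
    using A B yA yB by (simp_all add: qpoch_def)
  define f where "f k m = qsgn q (k + m) * vwp \<alpha> A B y (k + m) * qpoch_inf (\<alpha> * q ^ (N + 1 + (k + m))) q *
      (qcoef (k + m) k * (qpoch (\<alpha> * q ^ (k + m)) q k * qpoch b q k / (qpoch A q k * qpoch B q k)))" for k m
  have f: "f k m = qpoch b q k * qpoch \<alpha> q (2 * k) * y ^ k / (qpoch (y * A) q k * qpoch (y * B) q k) *
     (qsgn q m * vwp (\<alpha> * q ^ (2 * k)) (A * q ^ k) (B * q ^ k) y m * qpoch_inf (\<alpha> * q ^ (N + 1 + (k + m))) q)" for k m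
  proof -
    have "f k m = (qsgn q (k + m) * qcoef (k + m) k) * qpoch b q k * qpoch_inf (\<alpha> * q ^ (N + 1 + (k + m))) q *
       (vwp \<alpha> A B y (k + m) * (qpoch (\<alpha> * q ^ (k + m)) q k / (qpoch A q k * qpoch B q k)))"
      by (simp add: f_def)
    thus ?thesis
      unfolding qsgn_qcoef vwp_shift[OF nz(1,2)] by simp
  qed
  have "(\<Sum>n\<le>N. qbin q N n * (qsgn q n * vwp \<alpha> A B y n * qpoch_inf (\<alpha> * q ^ (N + 1 + n)) q * phi32 (\<alpha> * q ^ n) b A B n)) =
        (\<Sum>n\<le>N. qbin q N n * (\<Sum>k\<le>n. qbin q n k * f k (n - k)))"
    by (simp add: phi32_def f_def sum_distrib_left mult_ac)
  also have "\<dots> = (\<Sum>k\<le>N. qbin q N k * (\<Sum>m\<le>N - k. qbin q (N - k) m * f k m))"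
    by (rule sum_qbin_qbin)
  also have "\<dots> = (\<Sum>k\<le>N. qbin q N k * (qpoch_inf \<alpha> q / (qpoch (y * A) q N * qpoch (y * B) q N) *
      (qpoch b q k * y ^ k * qpoch y q (N - k))))"
  proof (intro sum.cong refl arg_cong2[of _ _ _ _ "(*)"])
    fix k assume "k \<in> {..N}"
    then obtain M where N: "N = k + M"
      using le_Suc_ex by auto
    \<comment> \<open>With N = k + M, the argument \<alpha> q^(N+1+k+m) equals \<alpha> q^(2k)
      q^(M+1+m), as the 6phi5 sum of length M with base \<alpha> q^(2k) requires.\<close>
    have "(\<Sum>m\<le>N - k. qbin q (N - k) m * f k m) =
        qpoch b q k * qpoch \<alpha> q (2 * k) * y ^ k / (qpoch (y * A) q k * qpoch (y * B) q k) *
       (\<Sum>m\<le>M. qbin q M m * (qsgn q m * vwp (\<alpha> * q ^ (2 * k)) (A * q ^ k) (B * q ^ k) y m *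
           qpoch_inf (\<alpha> * q ^ (2 * k) * q ^ (M + 1 + m)) q))"
      unfolding f sum_distrib_left by (simp add: N power_add mult_ac mult_2_right)
    also have "(\<Sum>m\<le>M. qbin q M m * (qsgn q m * vwp (\<alpha> * q ^ (2 * k)) (A * q ^ k) (B * q ^ k) y m *
           qpoch_inf (\<alpha> * q ^ (2 * k) * q ^ (M + 1 + m)) q)) =
        qpoch_inf (\<alpha> * q ^ (2 * k)) q * qpoch y q M / (qpoch (y * (A * q ^ k)) q M * qpoch (y * (B * q ^ k)) q M)"
    proof (rule terminating_6phi5)
      show "\<alpha> * q ^ (2 * k) * q = y * (A * q ^ k) * (B * q ^ k)"
        using rel by (simp add: power_add mult_2_right mult_ac)
      show "1 - y * (A * q ^ k) * q ^ j \<noteq> 0" "1 - y * (B * q ^ k) * q ^ j \<noteq> 0" for j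
        using one_minus_shift_nz[OF yA, of k j] one_minus_shift_nz[OF yB, of k j] by (simp_all add: mult.assoc)
    qed
    finally show "(\<Sum>m\<le>N - k. qbin q (N - k) m * f k m) =
       qpoch_inf \<alpha> q / (qpoch (y * A) q N * qpoch (y * B) q N) * (qpoch b q k * y ^ k * qpoch y q (N - k))"
      by (simp add: N qpoch_add[of "y * A"] qpoch_add[of "y * B"] qpoch_inf_split[of \<alpha> "2 * k"] mult.assoc[symmetric])
        (simp add: mult_ac)
  qed
  also have "\<dots> = qpoch_inf \<alpha> q / (qpoch (y * A) q N * qpoch (y * B) q N) *
      (\<Sum>k\<le>N. qbin q N k * (qpoch b q k * y ^ k * qpoch y q (N - k)))"
    by (simp add: sum_distrib_left mult_ac)
  also note q_vandermonde
  finally show ?thesis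
    by simp
qed

section \<open>Growth estimates uniform in the shift j\<close>

text \<open>Uniformity in j comes from 1 / (x q^j; q)_n = (x; q)_j / (x; q)_(j+n), whose numerator
  is bounded.\<close>

lemma inverse_qpoch_shift_bounded:
  assumes "qpoch_inf x q \<noteq> 0"
  obtains M where "M > 0" "\<And>j n. norm (inverse (qpoch (x * q ^ j) q n)) \<le> M"
proof -
  obtain M where M: "M > 0" "\<And>n. norm (inverse (qpoch x q n)) \<le> M"
    using inverse_qpoch_bounded[OF assms] by blast
  have nz: "qpoch x q n \<noteq> 0" for n
    using assms qpoch_inf_split[of x n] by auto
  have "norm (inverse (qpoch (x * q ^ j) q n)) \<le> exp (norm x / (1 - norm q)) * M" for j n
  proof -
    have "inverse (qpoch (x * q ^ j) q n) = qpoch x q j * inverse (qpoch x q (j + n))"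
      using nz[of j] by (simp add: qpoch_add)
    thus ?thesis
      by (simp only: norm_mult) (intro mult_mono M(2) norm_qpoch_le order_refl norm_ge_zero exp_ge_zero)
  qed
  thus ?thesis
    using M(1) by (intro that[of "exp (norm x / (1 - norm q)) * M"]) auto
qed

lemma qpoch_inf_q_nz: "qpoch_inf q q \<noteq> 0"
  by (simp add: qpoch_inf_eq_0_iff)

lemma qbin_bounded:
  obtains M where "M > 0" "\<And>n k. norm (qbin q n k) \<le> M"
proof -
  obtain K where K: "K > 0" "\<And>n. norm (inverse (qpoch q q n)) \<le> K"
    using inverse_qpoch_bounded[OF qpoch_inf_q_nz] by blast
  define E where "E = exp (norm q / (1 - norm q))"
  have "norm (qbin q n k) \<le> E * (K * K)" for n k
  proof (cases "k \<le> n")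
    case True
    hence "qbin q n k = qpoch q q n * (inverse (qpoch q q k) * inverse (qpoch q q (n - k)))"
      by (simp add: qbin_def field_simps)
    thus ?thesis
      unfolding E_def using K(1)
      by (simp only: norm_mult) (intro mult_mono K(2) norm_qpoch_le; simp)
  qed (use K in \<open>simp add: qbin_gt E_def\<close>)
  thus ?thesis
    using K(1) by (intro that[of "E * (K * K)"]) (auto simp: E_def)
qed

lemma norm_q_power_le_1: "norm q ^ n \<le> 1"
  using q1 by (simp add: power_le_one)

lemma norm_mult_q_power_le: "norm (x * q ^ n) \<le> norm x"
  using norm_q_power_le_1[of n] by (simp add: norm_mult norm_power mult_left_le)

lemma summable_theta:
  fixes x :: real
  assumes "x \<ge> 0"
  shows "summable (\<lambda>i. x ^ i * norm q ^ (i choose 2))"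
proof -
  have "(\<lambda>i. x * norm q ^ i) \<longlonglongrightarrow> x * 0"
    using q1 by (intro tendsto_intros LIMSEQ_power_zero) auto
  hence "eventually (\<lambda>i. x * norm q ^ i < 1 / 2) sequentially"
    by (rule order_tendstoD(2)) auto
  then obtain N where N: "\<And>i. i \<ge> N \<Longrightarrow> x * norm q ^ i \<le> 1 / 2"
    unfolding eventually_sequentially by (meson less_imp_le)
  show ?thesis
  proof (rule summable_ratio_test[of "1 / 2" N])
    fix i assume "i \<ge> N"
    have "norm (x ^ Suc i * norm q ^ (Suc i choose 2)) = (x * norm q ^ i) * (x ^ i * norm q ^ (i choose 2))"
      using assms by (simp add: numeral_2_eq_2 power_add abs_mult)
    also have "\<dots> \<le> 1 / 2 * (x ^ i * norm q ^ (i choose 2))"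
      using assms by (intro mult_right_mono N[OF \<open>i \<ge> N\<close>]) auto
    also have "\<dots> = 1 / 2 * norm (x ^ i * norm q ^ (i choose 2))"
      using assms by (simp add: abs_mult)
    finally show "norm (x ^ Suc i * norm q ^ (Suc i choose 2)) \<le> 1 / 2 * norm (x ^ i * norm q ^ (i choose 2))" .
  qed auto
qed

text \<open>For k < i \<le> m both x q^m and y q^k are O(|q|^k), so the product gains the Gaussian
  factor. This exploits that the parameter p of \<open>phi32\<close> contains q^m.\<close>

lemma norm_hpoch_small_le:
  assumes "i \<le> m"
  shows "norm (hpoch (x * q ^ m) y q i) \<le> (norm x + norm y) ^ i * norm q ^ (i choose 2)"
  using assms
proof (induction i)
  case (Suc i)
  have "norm (x * q ^ m - y * q ^ i) \<le> norm x * norm q ^ m + norm y * norm q ^ i"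
    by (metis norm_triangle_ineq4 norm_mult norm_power)
  also have "\<dots> \<le> norm x * norm q ^ i + norm y * norm q ^ i"
    using Suc.prems q1 by (intro add_mono mult_left_mono power_decreasing) auto
  finally have "norm (x * q ^ m - y * q ^ i) \<le> (norm x + norm y) * norm q ^ i"
    by (simp add: algebra_simps)
  hence "norm (hpoch (x * q ^ m) y q i) * norm (x * q ^ m - y * q ^ i) \<le>
      ((norm x + norm y) ^ i * norm q ^ (i choose 2)) * ((norm x + norm y) * norm q ^ i)"
    using Suc by (intro mult_mono) auto
  thus ?case
    by (simp add: hpoch_Suc norm_mult numeral_2_eq_2 power_add mult_ac)
qed (auto simp: numeral_2_eq_2)

text \<open>In the transformed sum the two \<open>hpoch\<close> factors together carry (q^j)^i
  (q^j)^(m-i) = q^(jm). This gain later offsets the growth caused by replacing d with d /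
  q^j.\<close>

lemma phi32_bound:
  assumes r: "r > 0" "norm b \<le> r" and A: "qpoch_inf A q \<noteq> 0" and B: "qpoch_inf B q \<noteq> 0"
  obtains C where "C > 0"
    "\<And>j m. norm (phi32 (\<alpha> * q ^ (2 * j) * q ^ m) (b * q ^ j) (A * q ^ j) (B * q ^ j) m) \<le> C * (norm q ^ j * r) ^ m"
proof -
  obtain MA where MA: "MA > 0" "\<And>j n. norm (inverse (qpoch (A * q ^ j) q n)) \<le> MA"
    using inverse_qpoch_shift_bounded[OF A] by blast
  obtain MB where MB: "MB > 0" "\<And>j n. norm (inverse (qpoch (B * q ^ j) q n)) \<le> MB"
    using inverse_qpoch_shift_bounded[OF B] by blast
  obtain K where K: "K > 0" "\<And>n k. norm (qbin q n k) \<le> K"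
    using qbin_bounded by blast
  define Eb where "Eb = exp (norm b / (1 - norm q))"
  define EB where "EB = exp (norm B / (r * (1 - norm q)))"
  \<comment> \<open>Dividing by r ^ i trades r ^ (m - i) for r ^ m; the Gaussian factor keeps the
    sum over i finite however small r is.\<close>
  define \<theta> where "\<theta> i = ((norm \<alpha> + norm A) / r) ^ i * norm q ^ (i choose 2)" for i
  define C where "C = K * Eb * MA * EB * MB * (suminf \<theta> + 1)"
  have \<theta>: "summable \<theta>" "\<theta> i \<ge> 0" for i
    unfolding \<theta>_def using r by (auto intro!: summable_theta mult_nonneg_nonneg)
  have Apos: "1 - A * q ^ j * q ^ k \<noteq> 0" and Bpos: "1 - B * q ^ j * q ^ k \<noteq> 0" for j k
    using A B one_minus_shift_nz qpoch_inf_eq_0_iff by blast+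
  have "norm (phi32 (\<alpha> * q ^ (2 * j) * q ^ m) (b * q ^ j) (A * q ^ j) (B * q ^ j) m) \<le> C * (norm q ^ j * r) ^ m" for j m
  proof -
    have term_le: "norm (qbin q m i * (qpoch (b * q ^ j) q i / qpoch (A * q ^ j) q i *
          hpoch (\<alpha> * q ^ (2 * j) * q ^ m) (A * q ^ j) q i * hpoch (b * q ^ j) (B * q ^ j) q (m - i)) / qpoch (B * q ^ j) q m)
        \<le> K * Eb * MA * EB * MB * (norm q ^ j * r) ^ m * \<theta> i" if "i \<le> m" for i
    proof -
      obtain l where m: "m = i + l"
        using \<open>i \<le> m\<close> by (metis le_iff_add)
      have "hpoch (\<alpha> * q ^ (2 * j) * q ^ m) (A * q ^ j) q i = (q ^ j) ^ i * hpoch (\<alpha> * q ^ (j + m)) A q i"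
        using hpoch_scale[of "q ^ j" "\<alpha> * q ^ (j + m)" A q i] by (simp add: power_add mult_2_right mult_ac)
      moreover have "norm (hpoch (\<alpha> * q ^ (j + m)) A q i) \<le> (norm \<alpha> + norm A) ^ i * norm q ^ (i choose 2)"
        using that by (intro norm_hpoch_small_le) auto
      ultimately have h1: "norm (hpoch (\<alpha> * q ^ (2 * j) * q ^ m) (A * q ^ j) q i) \<le>
          (norm q ^ j) ^ i * ((norm \<alpha> + norm A) ^ i * norm q ^ (i choose 2))"
        by (simp add: norm_mult norm_power mult_left_mono)
      have "hpoch (b * q ^ j) (B * q ^ j) q l = (q ^ j) ^ l * hpoch b B q l"
        using hpoch_scale[of "q ^ j" b B q l] by (simp add: mult.commute)
      moreover have "norm (hpoch b B q l) \<le> EB * r ^ l"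
        unfolding EB_def by (intro norm_hpoch_le r order_refl)
      ultimately have h2: "norm (hpoch (b * q ^ j) (B * q ^ j) q l) \<le> (norm q ^ j) ^ l * (EB * r ^ l)"
        by (simp add: norm_mult norm_power mult_left_mono)
      have h3: "norm (qpoch (b * q ^ j) q i) \<le> Eb"
        unfolding Eb_def by (intro norm_qpoch_le norm_mult_q_power_le)
      have "norm (qbin q m i * (qpoch (b * q ^ j) q i * inverse (qpoch (A * q ^ j) q i) *
          hpoch (\<alpha> * q ^ (2 * j) * q ^ m) (A * q ^ j) q i * hpoch (b * q ^ j) (B * q ^ j) q l) * inverse (qpoch (B * q ^ j) q m))
        \<le> K * (Eb * MA * ((norm q ^ j) ^ i * ((norm \<alpha> + norm A) ^ i * norm q ^ (i choose 2))) *
            ((norm q ^ j) ^ l * (EB * r ^ l))) * MB"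
        unfolding norm_mult using K MA MB r
        by (intro mult_mono K(2) h1 h2 h3 MA(2) MB(2) mult_nonneg_nonneg) (auto simp: Eb_def EB_def)
      also have "\<dots> = K * Eb * MA * EB * MB * (norm q ^ j * r) ^ m * \<theta> i"
        using r by (simp add: \<theta>_def m power_add power_mult_distrib power_divide)
      finally show ?thesis
        by (simp add: m divide_inverse)
    qed
    have "norm (phi32 (\<alpha> * q ^ (2 * j) * q ^ m) (b * q ^ j) (A * q ^ j) (B * q ^ j) m) \<le>
        (\<Sum>i\<le>m. K * Eb * MA * EB * MB * (norm q ^ j * r) ^ m * \<theta> i)"
      unfolding phi32_transformation[OF Apos Bpos] sum_divide_distrib
      by (rule sum_norm_le) (use term_le in auto)
    also have "\<dots> = K * Eb * MA * EB * MB * (norm q ^ j * r) ^ m * (\<Sum>i\<le>m. \<theta> i)"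
      by (simp add: sum_distrib_left)
    also have "\<dots> \<le> K * Eb * MA * EB * MB * (norm q ^ j * r) ^ m * (suminf \<theta> + 1)"
      using sum_le_suminf[OF \<theta>(1), of "{..m}"] \<theta>(2) K MA MB r
      by (intro mult_left_mono) (auto simp: Eb_def EB_def intro: add_increasing2)
    finally show ?thesis
      by (simp add: C_def mult_ac)
  qed
  moreover have "C > 0"
    unfolding C_def using K MA MB suminf_nonneg[OF \<theta>]
    by (intro mult_pos_pos) (auto simp: Eb_def EB_def)
  ultimately show ?thesis
    using that by blast
qed

lemma vwp_bound:
  assumes "qpoch_inf (y * A) q \<noteq> 0" "qpoch_inf (y * B) q \<noteq> 0"
  obtains C where "C > 0"
    "\<And>j m. norm (vwp (\<alpha> * q ^ (2 * j)) (A * q ^ j) (B * q ^ j) y m) \<le> C * norm y ^ m"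
proof -
  obtain MA where MA: "MA > 0" "\<And>j n. norm (inverse (qpoch (y * A * q ^ j) q n)) \<le> MA"
    using inverse_qpoch_shift_bounded[OF assms(1)] by blast
  obtain MB where MB: "MB > 0" "\<And>j n. norm (inverse (qpoch (y * B * q ^ j) q n)) \<le> MB"
    using inverse_qpoch_shift_bounded[OF assms(2)] by blast
  define E where "E x = exp (norm (x :: complex) / (1 - norm q))" for x
  define C where "C = (1 + norm \<alpha>) * E \<alpha> * E A * E B * (MA * MB)"
  have "norm (vwp (\<alpha> * q ^ (2 * j)) (A * q ^ j) (B * q ^ j) y m) \<le> C * norm y ^ m" for j m
  proof -
    have "norm (1 - \<alpha> * q ^ (2 * j) * q ^ (2 * m)) \<le> 1 + norm \<alpha>"
      using norm_triangle_ineq4[of 1 "\<alpha> * q ^ (2 * j + 2 * m)"] norm_mult_q_power_le[of \<alpha> "2 * j + 2 * m"]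
      by (simp add: power_add mult.assoc)
    moreover have "norm (qpoch (x * q ^ k) q m) \<le> E x" for x k
      unfolding E_def by (intro norm_qpoch_le norm_mult_q_power_le)
    ultimately have "norm ((1 - \<alpha> * q ^ (2 * j) * q ^ (2 * m)) * qpoch (\<alpha> * q ^ (2 * j)) q m *
       qpoch (A * q ^ j) q m * qpoch (B * q ^ j) q m *
       (inverse (qpoch (y * A * q ^ j) q m) * inverse (qpoch (y * B * q ^ j) q m)) * y ^ m) \<le> C * norm y ^ m"
      unfolding norm_mult C_def norm_power using MA MB
      by (intro mult_mono MA(2) MB(2) mult_nonneg_nonneg) (auto simp: E_def)
    thus ?thesis
      by (simp add: vwp_def divide_inverse mult.assoc)
  qed
  moreover have "C > 0"
    using MA MB by (auto simp: C_def E_def intro!: mult_pos_pos add_pos_nonneg)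
  ultimately show ?thesis
    using that by blast
qed

section \<open>The identity without the fourth parameter, by continuation in d\<close>

text \<open>Here \<open>d = c/q\<close>. The summand is multiplied by \<open>(\<alpha>c; q)_\<infinity>\<close>, which makes it entire in \<open>d\<close>.\<close>

definition gterm :: "complex \<Rightarrow> complex \<Rightarrow> complex \<Rightarrow> complex \<Rightarrow> complex \<Rightarrow> complex \<Rightarrow> nat \<Rightarrow> complex" where
  "gterm \<alpha> A B y b d n = vwp \<alpha> A B y n * hpoch d 1 q n / qpoch q q n *
     qpoch_inf (\<alpha> * q * d * q ^ n) q * phi32 (\<alpha> * q ^ n) b A B n"

text \<open>The product with second argument q^j grows at a rate independent of j; the blow-up of
  the shifted one is the explicit factor 1 / (q^j)^m.\<close>

lemma hpoch_shift_div: "hpoch d (q ^ j) q m = (q ^ j) ^ m * hpoch (d / q ^ j) 1 q m"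
  using q0 by (simp add: hpoch_scale[symmetric])

text \<open>Three rates multiply: |y| from \<open>vwp\<close>, R / |q|^j from the product in d /
  q^j, and |q|^j r from \<open>phi32\<close>; the powers of |q|^j cancel. The case j = 0 is the
  Weierstrass majorant, general j serves the double sum.\<close>

lemma gterm_bound:
  assumes r: "r > 0" "norm b \<le> r" and R: "R > 0"
    and nz: "qpoch_inf A q \<noteq> 0" "qpoch_inf B q \<noteq> 0" "qpoch_inf (y * A) q \<noteq> 0" "qpoch_inf (y * B) q \<noteq> 0"
  obtains C where "C > 0"
    "\<And>j m d. norm d \<le> R \<Longrightarrow>
       norm (gterm (\<alpha> * q ^ (2 * j)) (A * q ^ j) (B * q ^ j) y (b * q ^ j) (d / q ^ j) m) \<le> C * (norm y * r * R) ^ m"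
proof -
  obtain K where K: "K > 0" "\<And>n. norm (inverse (qpoch q q n)) \<le> K"
    using inverse_qpoch_bounded[OF qpoch_inf_q_nz] by blast
  obtain V where V: "V > 0"
    "\<And>j m. norm (vwp (\<alpha> * q ^ (2 * j)) (A * q ^ j) (B * q ^ j) y m) \<le> V * norm y ^ m"
    using vwp_bound[OF nz(3,4)] by blast
  obtain P where P: "P > 0"
    "\<And>j m. norm (phi32 (\<alpha> * q ^ (2 * j) * q ^ m) (b * q ^ j) (A * q ^ j) (B * q ^ j) m) \<le> P * (norm q ^ j * r) ^ m"
    using phi32_bound[OF r nz(1,2)] by blast
  define E1 where "E1 = exp (1 / (R * (1 - norm q)))"
  define E2 where "E2 = exp (norm \<alpha> * norm q * R / (1 - norm q))"
  define C where "C = V * E1 * K * E2 * P"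
  have "norm (gterm (\<alpha> * q ^ (2 * j)) (A * q ^ j) (B * q ^ j) y (b * q ^ j) (d / q ^ j) m) \<le> C * (norm y * r * R) ^ m"
    if d: "norm d \<le> R" for j m d
  proof -
    have "norm (hpoch d (q ^ j) q m) \<le> E1 * R ^ m"
      unfolding E1_def using norm_q_power_le_1[of j] by (intro norm_hpoch_le d R) (auto simp: norm_power)
    hence h: "norm (hpoch (d / q ^ j) 1 q m) \<le> E1 * R ^ m / (norm q ^ j) ^ m"
      unfolding hpoch_shift_div using norm_q_pos by (simp add: norm_mult norm_power pos_le_divide_eq mult.commute)
    have "norm (\<alpha> * q * d * q ^ (j + m)) \<le> norm \<alpha> * norm q * R"
      using norm_mult_q_power_le[of "\<alpha> * q * d" "j + m"] d
      by (simp add: norm_mult) (meson mult_left_mono mult_nonneg_nonneg norm_ge_zero order_trans)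
    moreover have "\<alpha> * q ^ (2 * j) * q * (d / q ^ j) * q ^ m = \<alpha> * q * d * q ^ (j + m)"
      using q0 by (simp add: power_add mult_2)
    ultimately have i: "norm (qpoch_inf (\<alpha> * q ^ (2 * j) * q * (d / q ^ j) * q ^ m) q) \<le> E2"
      unfolding E2_def by (intro norm_qpoch_inf_le) simp
    have "norm (gterm (\<alpha> * q ^ (2 * j)) (A * q ^ j) (B * q ^ j) y (b * q ^ j) (d / q ^ j) m) \<le>
        (V * norm y ^ m) * (E1 * R ^ m / (norm q ^ j) ^ m) * K * E2 * (P * (norm q ^ j * r) ^ m)"
      unfolding gterm_def divide_inverse[of _ "qpoch q q m"] norm_mult using K P V R
      by (intro mult_mono h i K(2) V(2) P(2) mult_nonneg_nonneg) (auto simp: E1_def E2_def)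
    also have "\<dots> = C * (norm y * r * R) ^ m"
      using norm_q_pos by (simp add: C_def power_mult_distrib)
    finally show ?thesis .
  qed
  moreover have "C > 0"
    unfolding C_def using K P V by (intro mult_pos_pos) (auto simp: E1_def E2_def)
  ultimately show ?thesis
    using that by blast
qed

text \<open>At d = q^N the factor with k = N vanishes, so \<open>gterm\<close> stops at n = N and
  its coefficients become those of the finite identity.\<close>

lemma hpoch_power_q: "hpoch (q ^ N) 1 q n / qpoch q q n = qbin q N n * qsgn q n"
proof (cases "n \<le> N")
  case True
  thus ?thesis
  proof (induction n)
    case (Suc n)
    then obtain l where N: "N = Suc (n + l)"
      by (metis add_Suc le_iff_add)
    have 1: "qbin q N n = qpoch q q N / (qpoch q q n * qpoch q q (Suc l))"
      "qbin q N (Suc n) = qpoch q q N / (qpoch q q (Suc n) * qpoch q q l)"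
      by (simp_all add: qbin_def N Suc_diff_le)
    have "hpoch (q ^ N) 1 q (Suc n) / qpoch q q (Suc n) =
          (hpoch (q ^ N) 1 q n / qpoch q q n) * (q ^ N - q ^ n) / (1 - q * q ^ n)"
      by (simp add: hpoch_Suc qpoch_Suc)
    also have "hpoch (q ^ N) 1 q n / qpoch q q n = qbin q N n * qsgn q n"
      using Suc by simp
    also have "\<dots> * (q ^ N - q ^ n) / (1 - q * q ^ n) = qbin q N (Suc n) * qsgn q (Suc n)"
      unfolding 1 by (simp add: qpoch_Suc[of _ _ l] qpoch_Suc[of _ _ n] qsgn_Suc N power_add divide_simps) algebra
    finally show ?case .
  qed auto
next
  case False
  hence "hpoch (q ^ N) 1 q n = 0"
    unfolding hpoch_def by (intro prod_zero bexI[of _ N]) auto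
  with False show ?thesis
    by (simp add: qbin_gt)
qed

lemma gterm_sums:
  assumes rel: "\<alpha> * q = y * A * B"
    and nz: "qpoch_inf A q \<noteq> 0" "qpoch_inf B q \<noteq> 0" "qpoch_inf (y * A) q \<noteq> 0" "qpoch_inf (y * B) q \<noteq> 0"
    and conv: "norm (y * b * d) < 1"
  shows "gterm \<alpha> A B y b d sums
    (qpoch_inf \<alpha> q * qpoch_inf (y * B * d) q * qpoch_inf (y * A * d) q * qpoch_inf (y * b) q /
      (qpoch_inf (y * A) q * qpoch_inf (y * B) q * qpoch_inf (y * b * d) q))"
proof -
  define S where "S d = qpoch_inf \<alpha> q * qpoch_inf (y * B * d) q * qpoch_inf (y * A * d) q * qpoch_inf (y * b) q /
      (qpoch_inf (y * A) q * qpoch_inf (y * B) q * qpoch_inf (y * b * d) q)" for d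
  \<comment> \<open>R just beyond |d| and r just beyond |b|, with |y| r R < 1, give a disc about 0
    that contains d and on which the majorant still converges; R is positive even for d = 0.\<close>
  obtain R where R: "R > norm d" "norm (y * b) * R < 1"
    using ex_greater_mult_less_one[of "norm (y * b)" "norm d"] conv by (auto simp: norm_mult)
  have Rpos: "R > 0"
    using R(1) norm_ge_zero[of d] by linarith
  obtain r where r: "r > norm b" "norm y * R * r < 1"
    using ex_greater_mult_less_one[of "norm y * R" "norm b"] R(2) Rpos by (auto simp: norm_mult mult_ac)
  have rpos: "r > 0"
    using r(1) norm_ge_zero[of b] by linarith
  obtain C where C: "C > 0" "\<And>j m d. norm d \<le> R \<Longrightarrow>
      norm (gterm (\<alpha> * q ^ (2 * j)) (A * q ^ j) (B * q ^ j) y (b * q ^ j) (d / q ^ j) m) \<le> C * (norm y * r * R) ^ m"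
    using gterm_bound[OF rpos less_imp_le[OF r(1)] Rpos nz] by blast
  define G where "G d = (\<Sum>n. gterm \<alpha> A B y b d n)" for d
  have ul: "uniform_limit (ball 0 R) (\<lambda>N d. \<Sum>n<N. gterm \<alpha> A B y b d n) G sequentially"
    unfolding G_def
  proof (rule Weierstrass_m_test)
    show "summable (\<lambda>n. C * (norm y * r * R) ^ n)"
      using r(2) rpos Rpos by (intro summable_mult summable_geometric) (simp add: mult_ac)
  qed (use C(2)[of _ 0] in auto)
  have holG: "G holomorphic_on ball 0 R"
  proof (rule holomorphic_uniform_sequence)
    show "(\<lambda>d. \<Sum>n<N. gterm \<alpha> A B y b d n) holomorphic_on ball 0 R" for N
      unfolding gterm_def hpoch_def by (intro holomorphic_intros) auto
    fix x :: complex assume "x \<in> ball 0 R"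
    then obtain e where "e > 0" "cball x e \<subseteq> ball 0 R"
      using open_contains_cball by blast
    thus "\<exists>e>0. cball x e \<subseteq> ball 0 R \<and> uniform_limit (cball x e) (\<lambda>N d. \<Sum>n<N. gterm \<alpha> A B y b d n) G sequentially"
      using uniform_limit_on_subset[OF ul] by blast
  qed auto
  have bd: "qpoch_inf x q \<noteq> 0" if "norm x < 1" for x
  proof
    assume "qpoch_inf x q = 0"
    then obtain k where "x * q ^ k = 1"
      by (auto simp: qpoch_inf_eq_0_iff)
    thus False
      using norm_mult_q_power_le[of x k] that by simp
  qed
  have bd': "qpoch_inf (y * b * x) q \<noteq> 0" if "x \<in> ball 0 R" for x
  proof (rule bd)
    have "norm (y * b * x) \<le> norm (y * b) * R"
      using that by (simp add: norm_mult mult_left_mono)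
    thus "norm (y * b * x) < 1"
      using R(2) by linarith
  qed
  have holS: "S holomorphic_on ball 0 R"
    unfolding S_def using nz bd' by (intro holomorphic_intros) auto
  have at_powers: "G (q ^ N) = S (q ^ N)" if "q ^ N \<in> ball 0 R" for N
  proof -
    have split: "qpoch_inf x q = qpoch x q N * qpoch_inf (x * q ^ N) q" for x
      by (rule qpoch_inf_split)
    have "G (q ^ N) = (\<Sum>n\<le>N. gterm \<alpha> A B y b (q ^ N) n)"
      unfolding G_def
    proof (rule suminf_finite)
      fix n assume "n \<notin> {..N}"
      hence "hpoch (q ^ N) 1 q n / qpoch q q n = 0"
        by (simp add: hpoch_power_q qbin_gt)
      thus "gterm \<alpha> A B y b (q ^ N) n = 0"
        by (simp add: gterm_def)
    qed auto
    also have "\<dots> = (\<Sum>n\<le>N. qbin q N n * (qsgn q n * vwp \<alpha> A B y n * qpoch_inf (\<alpha> * q ^ (N + 1 + n)) q * phi32 (\<alpha> * q ^ n) b A B n))"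
      unfolding gterm_def times_divide_eq_right[symmetric] hpoch_power_q
      by (simp add: power_add mult_ac)
    also have "\<dots> = qpoch_inf \<alpha> q * qpoch (b * y) q N / (qpoch (y * A) q N * qpoch (y * B) q N)"
      using nz by (intro terminating_expansion rel) (auto simp: qpoch_inf_eq_0_iff)
    \<comment> \<open>The infinite products at y A q^N, y B q^N and y b q^N cancel against the full
      ones, leaving exactly the finite products.\<close>
    also have "\<dots> = S (q ^ N)"
      using bd'[OF that] nz split[of "y * A"] split[of "y * B"] split[of "y * b"]
      by (auto simp: S_def mult.commute[of b])
    finally show ?thesis .
  qed
  have "G d - S d = 0"
  proof (rule analytic_continuation[of "\<lambda>d. G d - S d"])
    show "(\<lambda>d. G d - S d) holomorphic_on ball 0 R"
      by (intro holomorphic_intros holG holS)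
    show "range (\<lambda>N. q ^ N) \<inter> ball 0 R \<subseteq> ball 0 R"
      by auto
    have lim: "(\<lambda>N. q ^ N) \<longlonglongrightarrow> 0"
      using q1 by (intro LIMSEQ_power_zero)
    then obtain N0 where N0: "\<And>N. N \<ge> N0 \<Longrightarrow> q ^ N \<in> ball 0 R"
      using Rpos unfolding tendsto_iff eventually_sequentially by (auto simp: dist_commute)
    \<comment> \<open>Powers of q outside the disc are discarded by starting at N0; the remaining
      ones are nonzero and tend to 0.\<close>
    show "0 islimpt range (\<lambda>N. q ^ N) \<inter> ball 0 R"
      unfolding islimpt_sequential using N0 q0 LIMSEQ_ignore_initial_segment[OF lim, of N0]
      by (intro exI[of _ "\<lambda>n. q ^ (n + N0)"]) auto
  qed (use R Rpos at_powers in auto)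
  moreover have "(\<lambda>N. \<Sum>n<N. gterm \<alpha> A B y b d n) \<longlonglongrightarrow> G d"
    using R by (intro tendsto_uniform_limitI[OF ul]) auto
  ultimately show ?thesis
    by (simp add: sums_def S_def)
qed

section \<open>Restoring the fourth parameter\<close>

definition phi43 :: "complex \<Rightarrow> complex \<Rightarrow> complex \<Rightarrow> complex \<Rightarrow> complex \<Rightarrow> complex \<Rightarrow> nat \<Rightarrow> complex" where
  "phi43 p b c A B D n = (\<Sum>k\<le>n. qbin q n k * (qcoef n k *
     (qpoch p q k * qpoch b q k * qpoch c q k / (qpoch A q k * qpoch B q k * qpoch D q k))))"

text \<open>Only (c; q)_k / (D; q)_k is expanded. With c = \<gamma> and D = \<beta>\<gamma>u the
  factor \<open>hpoch c D q j\<close> is \<gamma>^j (\<beta>u; q)_j, the origin of the parameter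
  \<beta>u; the denominator (q^j)^(n-j) will turn d into d / q^j.\<close>

lemma phi43_expansion:
  assumes D: "\<And>k. 1 - D * q ^ k \<noteq> 0"
  shows "phi43 p b c A B D n = (\<Sum>j\<le>n. qbin q n j * (hpoch c D q j / qpoch D q j *
     (qpoch p q j * qpoch b q j / (qpoch A q j * qpoch B q j)) / (q ^ j) ^ (n - j) *
     phi32 (p * q ^ j) (b * q ^ j) (A * q ^ j) (B * q ^ j) (n - j)))"
proof -
  define f where "f j i = hpoch c D q j / qpoch D q j * (qcoef n (j + i) * qsgn q j) *
      (qpoch p q (j + i) * qpoch b q (j + i) / (qpoch A q (j + i) * qpoch B q (j + i)))" for j i
  have "phi43 p b c A B D n = (\<Sum>k\<le>n. qbin q n k * (qcoef n k * (qpoch p q k * qpoch b q k / (qpoch A q k * qpoch B q k) *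
      (\<Sum>j\<le>k. qbin q k j * (qsgn q j * (hpoch c D q j / qpoch D q j))))))"
    unfolding phi43_def qpoch_ratio_expansion[OF D] by (simp add: mult_ac)
  also have "\<dots> = (\<Sum>k\<le>n. qbin q n k * (\<Sum>j\<le>k. qbin q k j * f j (k - j)))"
    by (simp add: f_def sum_distrib_left mult_ac)
  also have "\<dots> = (\<Sum>j\<le>n. qbin q n j * (\<Sum>i\<le>n - j. qbin q (n - j) i * f j i))"
    by (rule sum_qbin_qbin)
  also have "\<dots> = (\<Sum>j\<le>n. qbin q n j * (hpoch c D q j / qpoch D q j *
     (qpoch p q j * qpoch b q j / (qpoch A q j * qpoch B q j)) / (q ^ j) ^ (n - j) *
     phi32 (p * q ^ j) (b * q ^ j) (A * q ^ j) (B * q ^ j) (n - j)))"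
  proof (intro sum.cong refl arg_cong2[of _ _ _ _ "(*)"])
    fix j assume "j \<in> {..n}"
    then obtain m where n: "n = m + j"
      by (metis atMost_iff le_iff_add add.commute)
    have "qcoef n (j + i) * qsgn q j = qcoef m i / (q ^ j) ^ m" for i
      using qcoef_add[of m j i] by (simp add: n mult.commute flip: power_mult)
    thus "(\<Sum>i\<le>n - j. qbin q (n - j) i * f j i) = hpoch c D q j / qpoch D q j *
       (qpoch p q j * qpoch b q j / (qpoch A q j * qpoch B q j)) / (q ^ j) ^ (n - j) *
       phi32 (p * q ^ j) (b * q ^ j) (A * q ^ j) (B * q ^ j) (n - j)"
      by (simp add: f_def n phi32_def sum_distrib_left qpoch_add mult_ac)
  qed
  finally show ?thesis .
qed

text \<open>Row j of the double sum is \<open>gterm_sums\<close> at (\<alpha>q^(2j), Aq^j, Bq^j,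
  bq^j, d/q^j). The products y A d, y B d and y b d are invariant under this shift, so one
  convergence condition serves all rows.\<close>

lemma phi43_sums:
  assumes rel: "\<alpha> * q = y * A * B"
    and nz: "qpoch_inf A q \<noteq> 0" "qpoch_inf B q \<noteq> 0" "qpoch_inf (y * A) q \<noteq> 0" "qpoch_inf (y * B) q \<noteq> 0"
      "qpoch_inf D q \<noteq> 0" "qpoch_inf (y * b) q \<noteq> 0"
    and conv: "norm (y * b * d) < 1" "norm (y * c * d) < 1" and d: "d \<noteq> 0"
  shows "(\<lambda>n. vwp \<alpha> A B y n * hpoch d 1 q n / qpoch q q n * qpoch_inf (\<alpha> * q * d * q ^ n) q *
      phi43 (\<alpha> * q ^ n) b c A B D n) sums
    (qpoch_inf \<alpha> q * qpoch_inf (y * B * d) q * qpoch_inf (y * A * d) q * qpoch_inf (y * b) q /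
      (qpoch_inf (y * A) q * qpoch_inf (y * B) q * qpoch_inf (y * b * d) q) *
      (\<Sum>j. qpoch b q j * hpoch c D q j * hpoch d 1 q j / (qpoch q q j * qpoch (y * b) q j * qpoch D q j) * y ^ j))"
proof -
  have nz': "qpoch x q n \<noteq> 0" if "qpoch_inf x q \<noteq> 0" for x n
    using that qpoch_inf_split[of x n] by auto
  have D: "1 - D * q ^ k \<noteq> 0" for k
    using nz(5) qpoch_inf_eq_0_iff by blast
  define P where "P = qpoch_inf \<alpha> q * qpoch_inf (y * B * d) q * qpoch_inf (y * A * d) q * qpoch_inf (y * b) q /
      (qpoch_inf (y * A) q * qpoch_inf (y * B) q * qpoch_inf (y * b * d) q)"
  define h where "h j = qpoch b q j * hpoch c D q j * hpoch d 1 q j / (qpoch q q j * qpoch (y * b) q j * qpoch D q j) * y ^ j" for j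
  \<comment> \<open>The part of row j that does not depend on m; the powers of y,
    \<open>hpoch c D q j\<close> and \<open>hpoch d 1 q j\<close> determine its decay in j.\<close>
  define u where "u j = hpoch c D q j / qpoch D q j * (qpoch b q j / (qpoch q q j * (qpoch (y * A) q j * qpoch (y * B) q j))) *
      y ^ j * qpoch \<alpha> q (2 * j) * hpoch d 1 q j" for j
  define f where "f j m = u j * gterm (\<alpha> * q ^ (2 * j)) (A * q ^ j) (B * q ^ j) y (b * q ^ j) (d / q ^ j) m" for j m
  have f_eq: "(\<Sum>j\<le>n. f j (n - j)) = vwp \<alpha> A B y n * hpoch d 1 q n / qpoch q q n * qpoch_inf (\<alpha> * q * d * q ^ n) q *
      phi43 (\<alpha> * q ^ n) b c A B D n" for n
  proof -
    have f_term: "f j (n - j) = vwp \<alpha> A B y n * hpoch d 1 q n / qpoch q q n * qpoch_inf (\<alpha> * q * d * q ^ n) q *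
       (qbin q n j * (hpoch c D q j / qpoch D q j *
     (qpoch (\<alpha> * q ^ n) q j * qpoch b q j / (qpoch A q j * qpoch B q j)) / (q ^ j) ^ (n - j) *
     phi32 (\<alpha> * q ^ n * q ^ j) (b * q ^ j) (A * q ^ j) (B * q ^ j) (n - j)))" if "j \<le> n" for j
    proof -
      obtain m where n: "n = j + m"
        using \<open>j \<le> n\<close> le_Suc_ex by blast
      \<comment> \<open>The denominator left by \<open>phi43_expansion\<close> is absorbed by
        rescaling d.\<close>
      have 1: "hpoch d 1 q (j + m) / (q ^ j) ^ m = hpoch d 1 q j * hpoch (d / q ^ j) 1 q m"
        using q0 hpoch_shift_div[of d j m] by (simp add: hpoch_add)
      have 2: "qbin q (j + m) j / qpoch q q (j + m) = 1 / (qpoch q q j * qpoch q q m)"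
        by (simp add: qbin_def)
      have 3: "\<alpha> * q ^ (2 * j) * q * (d / q ^ j) * q ^ m = \<alpha> * q * d * q ^ (j + m)"
        using q0 by (simp add: power_add mult_2)
      have 4: "\<alpha> * q ^ (2 * j) * q ^ m = \<alpha> * q ^ (j + m) * q ^ j"
        by (simp add: power_add mult_2)
      have "f j m = (hpoch d 1 q j * hpoch (d / q ^ j) 1 q m) * (1 / (qpoch q q j * qpoch q q m)) *
          (qpoch \<alpha> q (2 * j) * y ^ j / (qpoch (y * A) q j * qpoch (y * B) q j) *
            vwp (\<alpha> * q ^ (2 * j)) (A * q ^ j) (B * q ^ j) y m) *
          (hpoch c D q j / qpoch D q j * qpoch b q j * qpoch_inf (\<alpha> * q * d * q ^ (j + m)) q *
            phi32 (\<alpha> * q ^ (j + m) * q ^ j) (b * q ^ j) (A * q ^ j) (B * q ^ j) m)"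
        unfolding f_def u_def gterm_def 3 4
        by (simp only: divide_inverse inverse_mult_distrib mult_1_left mult_ac)
      also have "\<dots> = (hpoch d 1 q (j + m) / (q ^ j) ^ m) * (qbin q (j + m) j / qpoch q q (j + m)) *
          (vwp \<alpha> A B y (j + m) * (qpoch (\<alpha> * q ^ (j + m)) q j / (qpoch A q j * qpoch B q j))) *
          (hpoch c D q j / qpoch D q j * qpoch b q j * qpoch_inf (\<alpha> * q * d * q ^ (j + m)) q *
            phi32 (\<alpha> * q ^ (j + m) * q ^ j) (b * q ^ j) (A * q ^ j) (B * q ^ j) m)"
        unfolding 1 2 vwp_shift[OF nz'[OF nz(1)] nz'[OF nz(2)]] ..
      finally show ?thesis
        by (simp only: n diff_add_inverse divide_inverse inverse_mult_distrib mult_ac)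
    qed
    show ?thesis
      unfolding phi43_expansion[OF D] sum_distrib_left by (intro sum.cong refl f_term) simp
  qed
  have inner: "f j sums (P * h j)" for j
  proof -
    have shift: "qpoch_inf (x * q ^ j) q = qpoch_inf x q / qpoch x q j" if "qpoch_inf x q \<noteq> 0" for x
      using qpoch_inf_split[of x j] nz'[OF that, of j] by (simp add: field_simps)
    have shift_nz: "qpoch_inf (x * q ^ j) q \<noteq> 0" if "qpoch_inf x q \<noteq> 0" for x
      using qpoch_inf_split[of x j] that by auto
    have simps: "y * (A * q ^ j) = y * A * q ^ j" "y * (B * q ^ j) = y * B * q ^ j" "y * (b * q ^ j) = y * b * q ^ j"
      "y * A * q ^ j * (d / q ^ j) = y * A * d" "y * B * q ^ j * (d / q ^ j) = y * B * d"
      "y * b * q ^ j * (d / q ^ j) = y * b * d"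
      using q0 by (simp_all add: mult_ac)
    have "gterm (\<alpha> * q ^ (2 * j)) (A * q ^ j) (B * q ^ j) y (b * q ^ j) (d / q ^ j) sums
     (qpoch_inf (\<alpha> * q ^ (2 * j)) q * qpoch_inf (y * (B * q ^ j) * (d / q ^ j)) q * qpoch_inf (y * (A * q ^ j) * (d / q ^ j)) q *
       qpoch_inf (y * (b * q ^ j)) q /
      (qpoch_inf (y * (A * q ^ j)) q * qpoch_inf (y * (B * q ^ j)) q * qpoch_inf (y * (b * q ^ j) * (d / q ^ j)) q))"
    proof (rule gterm_sums)
      show "\<alpha> * q ^ (2 * j) * q = y * (A * q ^ j) * (B * q ^ j)"
        using rel by (simp add: power_add mult_2_right mult_ac)
      show "norm (y * (b * q ^ j) * (d / q ^ j)) < 1"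
        using conv(1) by (simp only: simps)
      show "qpoch_inf (A * q ^ j) q \<noteq> 0" "qpoch_inf (B * q ^ j) q \<noteq> 0"
        by (intro shift_nz nz)+
      show "qpoch_inf (y * (A * q ^ j)) q \<noteq> 0" "qpoch_inf (y * (B * q ^ j)) q \<noteq> 0"
        unfolding simps by (intro shift_nz nz)+
    qed
    hence "gterm (\<alpha> * q ^ (2 * j)) (A * q ^ j) (B * q ^ j) y (b * q ^ j) (d / q ^ j) sums
     (qpoch_inf (\<alpha> * q ^ (2 * j)) q * qpoch_inf (y * B * d) q * qpoch_inf (y * A * d) q *
       (qpoch_inf (y * b) q / qpoch (y * b) q j) /
      ((qpoch_inf (y * A) q / qpoch (y * A) q j) * (qpoch_inf (y * B) q / qpoch (y * B) q j) * qpoch_inf (y * b * d) q))"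
      by (simp only: simps shift[OF nz(3)] shift[OF nz(4)] shift[OF nz(6)])
    from sums_mult[OF this, of "u j"] show ?thesis
      unfolding f_def[abs_def]
      by (rule back_subst[where P = "\<lambda>x. _ sums x"])
         (use nz'[OF nz(3), of j] nz'[OF nz(4), of j] in
           \<open>simp add: u_def P_def h_def qpoch_inf_split[of \<alpha> "2 * j"] mult_ac\<close>)
  qed
  have dpos: "norm d > 0"
    using d by simp
  \<comment> \<open>The two convergence hypotheses act separately: r > |b| controls the sum over m,
    r' > |c| the sum over j.\<close>
  obtain r where r: "r > norm b" "norm y * norm d * r < 1"
    using ex_greater_mult_less_one[of "norm y * norm d" "norm b"] conv(1) by (auto simp: norm_mult mult_ac)
  obtain r' where r': "r' > norm c" "norm y * norm d * r' < 1"
    using ex_greater_mult_less_one[of "norm y * norm d" "norm c"] conv(2) by (auto simp: norm_mult mult_ac)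
  have rpos: "r > 0" "r' > 0"
    using r(1) r'(1) norm_ge_zero[of b] norm_ge_zero[of c] by linarith+
  obtain C where C: "C > 0" "\<And>j m x. norm x \<le> norm d \<Longrightarrow>
      norm (gterm (\<alpha> * q ^ (2 * j)) (A * q ^ j) (B * q ^ j) y (b * q ^ j) (x / q ^ j) m) \<le> C * (norm y * r * norm d) ^ m"
    using gterm_bound[OF rpos(1) less_imp_le[OF r(1)] dpos nz(1-4)] by blast
  obtain K where K: "K > 0" "\<And>j. norm (u j) \<le> K * (norm y * norm d * r') ^ j"
  proof -
    \<comment> \<open>Stated for every x, vacuously where the product vanishes, so that one choice
      function M bounds all reciprocals.\<close>
    have "\<exists>M. qpoch_inf x q \<noteq> 0 \<longrightarrow> M > 0 \<and> (\<forall>n. norm (inverse (qpoch x q n)) \<le> M)" for x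
      by (cases "qpoch_inf x q = 0") (auto elim: inverse_qpoch_bounded)
    then obtain M where M': "\<And>x. qpoch_inf x q \<noteq> 0 \<longrightarrow> M x > 0 \<and> (\<forall>n. norm (inverse (qpoch x q n)) \<le> M x)"
      by metis
    have M: "M x > 0" "norm (inverse (qpoch x q n)) \<le> M x" if "qpoch_inf x q \<noteq> 0" for x n
      using M' that by blast+
    define E where "E x = exp (norm (x :: complex) / (1 - norm q))" for x
    define E1 where "E1 = exp (norm D / (r' * (1 - norm q)))"
    define E2 where "E2 = exp (1 / (norm d * (1 - norm q)))"
    define K where "K = E1 * M D * (E b * (M q * (M (y * A) * M (y * B)))) * E \<alpha> * E2"
    have Mpos: "M D > 0" "M q > 0" "M (y * A) > 0" "M (y * B) > 0"
      using nz qpoch_inf_q_nz M(1) by auto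
    have "norm (u j) \<le> K * (norm y * norm d * r') ^ j" for j
    proof -
      have E: "norm (qpoch x q n) \<le> E x" for x n
        unfolding E_def by (intro norm_qpoch_le order_refl)
      have E1: "norm (hpoch c D q j) \<le> E1 * r' ^ j"
        unfolding E1_def using r' rpos by (intro norm_hpoch_le) auto
      have E2: "norm (hpoch d 1 q j) \<le> E2 * norm d ^ j"
        unfolding E2_def using dpos by (intro norm_hpoch_le) auto
      have "norm (hpoch c D q j * inverse (qpoch D q j) * (qpoch b q j * (inverse (qpoch q q j) *
          (inverse (qpoch (y * A) q j) * inverse (qpoch (y * B) q j)))) * y ^ j * qpoch \<alpha> q (2 * j) * hpoch d 1 q j) \<le>
        (E1 * r' ^ j) * M D * (E b * (M q * (M (y * A) * M (y * B)))) * norm y ^ j * E \<alpha> * (E2 * norm d ^ j)"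
        unfolding norm_mult norm_power using Mpos rpos
        by (intro mult_mono E E1 E2 M(2) nz qpoch_inf_q_nz mult_nonneg_nonneg) (auto simp: E_def E1_def E2_def)
      also have "\<dots> = K * (norm y * norm d * r') ^ j"
        by (simp add: K_def power_mult_distrib)
      finally show ?thesis
        by (simp add: u_def divide_inverse mult_ac)
    qed
    moreover have "K > 0"
      unfolding K_def using Mpos by (intro mult_pos_pos) (auto simp: E_def E1_def E2_def)
    ultimately show ?thesis
      using that by blast
  qed
  have bound: "norm (f j m) \<le> (K * C) * (norm y * norm d * r') ^ j * (norm y * r * norm d) ^ m" for j m
  proof -
    have "norm (f j m) \<le> (K * (norm y * norm d * r') ^ j) * (C * (norm y * r * norm d) ^ m)"
      unfolding f_def norm_mult using K C rpos by (intro mult_mono K(2) C(2)) auto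
    thus ?thesis
      by (simp add: mult_ac)
  qed
  note swap = sums_triangle_swap[OF bound _ _ _ _ inner]
  have "norm y * norm d * r' \<ge> 0" "norm y * r * norm d \<ge> 0" "norm y * r * norm d < 1"
    using r(2) rpos by (simp_all add: mult_ac)
  note swap = swap[OF this(1) r'(2) this(2,3)]
  have "(\<Sum>j. P * h j) = P * suminf h"
  \<comment> \<open>Summability is known only for P times h; it passes to h when P is nonzero, and
    for P = 0 both sides are 0.\<close>
  proof (cases "P = 0")
    case False
    with swap(1) have "summable h"
      by (simp add: summable_cmult_iff)
    thus ?thesis
      by (rule suminf_mult)
  qed auto
  with swap(2) show ?thesis
    by (simp only: f_eq P_def h_def[abs_def])
qed

section \<open>Translation into basic hypergeometric notation\<close>

lemma qpoch_inverse_power: "qpoch (1 / q ^ n) q k / qpoch q q k * q ^ k = qbin q n k * qcoef n k"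
proof -
  have "hpoch (q ^ n) 1 q k = (q ^ n) ^ k * qpoch (1 / q ^ n) q k"
    using hpoch_scale[of "q ^ n" 1 "1 / q ^ n" q k] q0 by (simp add: qpoch_conv_hpoch)
  with hpoch_power_q[of n k] have "qpoch (1 / q ^ n) q k / qpoch q q k * (q ^ n) ^ k = qbin q n k * qsgn q k"
    by (simp add: mult.commute)
  hence "qpoch (1 / q ^ n) q k / qpoch q q k = qbin q n k * qsgn q k / (q ^ n) ^ k"
    using q0 by (subst nonzero_eq_divide_eq) auto
  thus ?thesis
    by (simp add: qcoef_def power_mult)
qed

lemma qphi_4_3: "qphi [1 / q ^ n, p, b, c] [A, B, D] q q = phi43 p b c A B D n"
proof -
  have "qphi [1 / q ^ n, p, b, c] [A, B, D] q q =
      (\<Sum>k. qbin q n k * (qcoef n k * (qpoch p q k * qpoch b q k * qpoch c q k / (qpoch A q k * qpoch B q k * qpoch D q k))))"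
    unfolding qphi_def
  proof (rule suminf_cong)
    fix k
    have "qpochs [1 / q ^ n, p, b, c] q k / qpochs [q, A, B, D] q k * q ^ k =
        (qpoch (1 / q ^ n) q k / qpoch q q k * q ^ k) *
        (qpoch p q k * qpoch b q k * qpoch c q k / (qpoch A q k * qpoch B q k * qpoch D q k))"
      by (simp add: qpochs_def mult_ac)
    thus "qpochs [1 / q ^ n, p, b, c] q k / qpochs [q, A, B, D] q k *
        ((-1) ^ k * q ^ (k * (k - 1) div 2)) powi (int (1 + length [A, B, D]) - int (length [1 / q ^ n, p, b, c])) * q ^ k =
        qbin q n k * (qcoef n k * (qpoch p q k * qpoch b q k * qpoch c q k / (qpoch A q k * qpoch B q k * qpoch D q k)))"
      \<comment> \<open>The exponent 1 + 3 - 4 of the quadratic factor is 0.\<close>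
      unfolding qpoch_inverse_power by simp
  qed
  also have "\<dots> = phi43 p b c A B D n"
    unfolding phi43_def by (rule suminf_finite) (auto simp: qbin_gt)
  finally show ?thesis .
qed

end

theorem theorem5p1:
  fixes q \<alpha> a b c \<beta> \<gamma> u :: complex
  assumes q: "0 < norm q" "norm q < 1"
    and conv: "max (norm (\<alpha> * \<beta> * a * b * c / q ^ 2)) (norm (\<alpha> * \<gamma> * a * b * c / q ^ 2)) < 1"
    and nz_abc: "a \<noteq> 0" "b \<noteq> 0" "c \<noteq> 0"
    and nz_alpha: "\<alpha> \<noteq> 1"
    and nz_den1: "qpochs_inf [\<alpha> * a, \<alpha> * b, \<alpha> * c] q \<noteq> 0"
    and nz_den2: "qpochs_inf [q / a, q / b, \<beta> * \<gamma> * u] q \<noteq> 0"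
    and nz_den3: "qpoch_inf (\<alpha> * \<beta> * a * b / q) q \<noteq> 0"
  shows "(\<lambda>n. (1 - \<alpha> * q ^ (2 * n)) * qpochs [\<alpha>, q / a, q / b, q / c] q n
            / ((1 - \<alpha>) * qpochs [q, \<alpha> * a, \<alpha> * b, \<alpha> * c] q n)
            * (\<alpha> * a * b * c / q ^ 2) ^ n
            * qphi [1 / q ^ n, \<alpha> * q ^ n, \<beta>, \<gamma>] [q / a, q / b, \<beta> * \<gamma> * u] q q)
         sums (qpochs_inf [q * \<alpha>, \<alpha> * a * c / q, \<alpha> * b * c / q, \<alpha> * \<beta> * a * b / q] q
               / qpochs_inf [\<alpha> * a, \<alpha> * b, \<alpha> * c, \<alpha> * \<beta> * a * b * c / q ^ 2] q
               * qphi [q / c, \<beta> * u, \<beta>] [\<alpha> * \<beta> * a * b / q, \<beta> * \<gamma> * u] q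
                   (\<alpha> * \<gamma> * a * b * c / q ^ 2))"
proof -
  interpret q_base q
    by unfold_locales (use q in auto)
  \<comment> \<open>The dictionary to the lemmas is A = q/a, B = q/b, b = \<beta>, c = \<gamma>, D =
    \<beta>\<gamma>u.\<close>
  define y d where "y = \<alpha> * a * b / q" and "d = c / q"
  have params: "\<alpha> * q = y * (q / a) * (q / b)" "y * (q / a) = \<alpha> * b" "y * (q / b) = \<alpha> * a"
      "y * \<beta> = \<alpha> * \<beta> * a * b / q" "\<alpha> * \<beta> * a * b / q * d = \<alpha> * \<beta> * a * b * c / q ^ 2"
      "y * \<gamma> * d = \<alpha> * \<gamma> * a * b * c / q ^ 2" "\<alpha> * b * d = \<alpha> * b * c / q" "\<alpha> * a * d = \<alpha> * a * c / q"
      "\<alpha> * q * d = \<alpha> * c"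
    using q0 nz_abc by (simp_all add: y_def d_def power2_eq_square)
  have nz: "qpoch_inf (\<alpha> * a) q \<noteq> 0" "qpoch_inf (\<alpha> * b) q \<noteq> 0" "qpoch_inf (\<alpha> * c) q \<noteq> 0"
      "qpoch_inf (q / a) q \<noteq> 0" "qpoch_inf (q / b) q \<noteq> 0" "qpoch_inf (\<beta> * \<gamma> * u) q \<noteq> 0"
    using nz_den1 nz_den2 by (simp_all add: qpochs_inf_def)
  define F where "F n = vwp \<alpha> (q / a) (q / b) y n * hpoch d 1 q n / qpoch q q n * qpoch_inf (\<alpha> * q * d * q ^ n) q *
      phi43 (\<alpha> * q ^ n) \<beta> \<gamma> (q / a) (q / b) (\<beta> * \<gamma> * u) n" for n
  define H where "H j = qpoch \<beta> q j * hpoch \<gamma> (\<beta> * \<gamma> * u) q j * hpoch d 1 q j /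
      (qpoch q q j * qpoch (y * \<beta>) q j * qpoch (\<beta> * \<gamma> * u) q j) * y ^ j" for j
  have hpoch_d: "hpoch d 1 q n = d ^ n * qpoch (q / c) q n" for n
    using hpoch_scale[of d 1 "q / c" q n] q0 nz_abc by (simp add: d_def qpoch_conv_hpoch)
  have F_sums: "F sums (qpoch_inf \<alpha> q * qpoch_inf (y * (q / b) * d) q * qpoch_inf (y * (q / a) * d) q * qpoch_inf (y * \<beta>) q /
      (qpoch_inf (y * (q / a)) q * qpoch_inf (y * (q / b)) q * qpoch_inf (y * \<beta> * d) q) * suminf H)"
    unfolding F_def[abs_def] H_def[abs_def]
  proof (rule phi43_sums)
    show "qpoch_inf (y * (q / a)) q \<noteq> 0" "qpoch_inf (y * (q / b)) q \<noteq> 0" "qpoch_inf (y * \<beta>) q \<noteq> 0"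
      unfolding params by (rule nz nz_den3)+
    show "norm (y * \<beta> * d) < 1" "norm (y * \<gamma> * d) < 1"
      unfolding params using conv by simp_all
    show "d \<noteq> 0"
      using q0 nz_abc by (simp add: d_def)
  qed (rule params(1) nz)+
  \<comment> \<open>Division by (1 - \<alpha>) (\<alpha>c; q)_\<infinity> undoes the normalisation
    of \<open>gterm\<close>: the tail product becomes 1 / (\<alpha>c; q)_n.\<close>
  have term_eq: "F n / ((1 - \<alpha>) * qpoch_inf (\<alpha> * c) q) =
      (1 - \<alpha> * q ^ (2 * n)) * qpochs [\<alpha>, q / a, q / b, q / c] q n
            / ((1 - \<alpha>) * qpochs [q, \<alpha> * a, \<alpha> * b, \<alpha> * c] q n)
            * (\<alpha> * a * b * c / q ^ 2) ^ n
            * qphi [1 / q ^ n, \<alpha> * q ^ n, \<beta>, \<gamma>] [q / a, q / b, \<beta> * \<gamma> * u] q q" for n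
  proof -
    have "qpoch_inf (\<alpha> * c) q = qpoch (\<alpha> * c) q n * qpoch_inf (\<alpha> * c * q ^ n) q"
      by (rule qpoch_inf_split)
    hence "qpoch_inf (\<alpha> * q * d * q ^ n) q / qpoch_inf (\<alpha> * c) q = 1 / qpoch (\<alpha> * c) q n"
      unfolding params(9) using nz(3) by auto
    moreover have "(\<alpha> * a * b * c / q ^ 2) ^ n = y ^ n * d ^ n"
      by (simp add: y_def d_def power2_eq_square flip: power_mult_distrib)
    moreover have "F n / ((1 - \<alpha>) * qpoch_inf (\<alpha> * c) q) =
        (1 - \<alpha> * q ^ (2 * n)) * qpochs [\<alpha>, q / a, q / b, q / c] q n
            / ((1 - \<alpha>) * (qpoch q q n * qpoch (\<alpha> * a) q n * qpoch (\<alpha> * b) q n)) *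
        (qpoch_inf (\<alpha> * q * d * q ^ n) q / qpoch_inf (\<alpha> * c) q) * (y ^ n * d ^ n) *
        phi43 (\<alpha> * q ^ n) \<beta> \<gamma> (q / a) (q / b) (\<beta> * \<gamma> * u) n"
      unfolding F_def vwp_def hpoch_d params(2,3) by (simp add: qpochs_def mult_ac)
    ultimately show ?thesis
      unfolding qphi_4_3 by (simp add: qpochs_def mult_ac)
  qed
  have H_eq: "suminf H = qphi [q / c, \<beta> * u, \<beta>] [\<alpha> * \<beta> * a * b / q, \<beta> * \<gamma> * u] q (\<alpha> * \<gamma> * a * b * c / q ^ 2)"
    unfolding qphi_def
  proof (rule suminf_cong)
    fix j
    have "hpoch \<gamma> (\<beta> * \<gamma> * u) q j = \<gamma> ^ j * qpoch (\<beta> * u) q j"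
      using hpoch_scale[of \<gamma> 1 "\<beta> * u" q j] by (simp add: qpoch_conv_hpoch mult_ac)
    moreover have "(\<alpha> * \<gamma> * a * b * c / q ^ 2) ^ j = y ^ j * \<gamma> ^ j * d ^ j"
      by (simp add: params(6)[symmetric] power_mult_distrib)
    ultimately show "H j = qpochs [q / c, \<beta> * u, \<beta>] q j / qpochs [q, \<alpha> * \<beta> * a * b / q, \<beta> * \<gamma> * u] q j *
        ((-1) ^ j * q ^ (j * (j - 1) div 2)) powi (int (1 + length [\<alpha> * \<beta> * a * b / q, \<beta> * \<gamma> * u]) -
           int (length [q / c, \<beta> * u, \<beta>])) * (\<alpha> * \<gamma> * a * b * c / q ^ 2) ^ j"
      unfolding H_def hpoch_d params(4) by (simp add: qpochs_def mult_ac)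
  qed
  have "qpoch_inf \<alpha> q = (1 - \<alpha>) * qpoch_inf (q * \<alpha>) q"
    using qpoch_inf_Suc[of \<alpha>] by (simp add: mult.commute)
  with sums_divide[OF F_sums, of "(1 - \<alpha>) * qpoch_inf (\<alpha> * c) q"] show ?thesis
    using nz_alpha unfolding term_eq H_eq params(2-9) by (simp add: qpochs_inf_def mult_ac)
qed

end
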